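(* Let $H$ be a separable infinite-dimensional complex Hilbert space and let $\alpha:\mathbb{N}_0\to[0,\infty)$ be a monotone increasing function with $\alpha(0)=0$ and $\alpha(1)>0$. Put $c_i:=\alpha(i)-\alpha(i-1)$ for $i=1,2,3,\dots$, let $\varphi_\alpha$ be the non-linear trace of Choquet type associated with $\alpha$, and define $|||a|||_\alpha:=\varphi_\alpha(|a|)\in[0,\infty]$ for $a\in K(H)$. Then the following conditions are equivalent: (1) $\alpha$ is concave in the sense that $\frac{\alpha(i+1)+\alpha(i-1)}{2}\le\alpha(i)$ for $i=1,2,3,\dots$. (2) $(c_i)_i$ is a decreasing sequence: $c_1\ge c_2\ge\cdots\ge c_n\ge\cdots$. (3) $|||\cdot|||_\alpha$ satisfies the triangle inequality: for any $a,b\in K(H)$, $|||a+b|||_\alpha\le|||a|||_\alpha+|||b|||_\alpha$, admitting the value $+\infty$.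
   Context: $\mathbb{N}_0=\{0,1,2,\dots\}$; $K(H)$ is the algebra of compact operators on $H$, $K(H)^+$ its positive elements, $|a|=(a^*a)^{1/2}$. For $a\in K(H)^+$, $\lambda_1(a)\ge\lambda_2(a)\ge\cdots$ denotes the sequence of nonzero eigenvalues of $a$ in decreasing order counted with multiplicity (completed by zeros if $a$ has finite rank). The non-linear trace of Choquet type associated with $\alpha$ is $\varphi_\alpha:K(H)^+\to[0,\infty]$, $\varphi_\alpha(a)=\sum_{i=1}^\infty(\lambda_i(a)-\lambda_{i+1}(a))\alpha(i)$, which also equals $\sum_{i=1}^\infty c_i\lambda_i(a)$. *)

theory Defs
  imports "HOL-Analysis.Analysis"
begin

text \<open>
  Complex Hilbert spaces. The inner product \<open>cinner\<close> is linear in the first argument; its real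
  part is the real inner product of the class \<^class>\<open>real_inner\<close>. Positive definiteness of
  \<open>cinner\<close> and the identity \<open>norm x = sqrt (Re (cinner x x))\<close> are thereby inherited from
  \<^class>\<open>real_inner\<close>, and completeness refers to this norm.
\<close>

class complex_hilbert = real_inner + complete_space +
  fixes scaleC :: "complex \<Rightarrow> 'a \<Rightarrow> 'a"  (infixr \<open>*\<^sub>C\<close> 75)
    and cinner :: "'a \<Rightarrow> 'a \<Rightarrow> complex"
  assumes scaleC_add_right: "c *\<^sub>C (x + y) = c *\<^sub>C x + c *\<^sub>C y"
    and scaleC_add_left: "(c + d) *\<^sub>C x = c *\<^sub>C x + d *\<^sub>C x"
    and scaleC_scaleC: "c *\<^sub>C d *\<^sub>C x = (c * d) *\<^sub>C x"
    and scaleC_one: "1 *\<^sub>C x = x"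
    and scaleC_of_real: "complex_of_real r *\<^sub>C x = r *\<^sub>R x"
    and cinner_commute: "cinner x y = cnj (cinner y x)"
    and cinner_add_left: "cinner (x + y) z = cinner x z + cinner y z"
    and cinner_scaleC_left: "cinner (c *\<^sub>C x) y = c * cinner x y"
    and Re_cinner: "Re (cinner x y) = inner x y"

global_interpretation cspace: vector_space "scaleC :: complex \<Rightarrow> 'a \<Rightarrow> 'a::complex_hilbert"
  by unfold_locales (simp_all add: scaleC_add_right scaleC_add_left scaleC_scaleC scaleC_one)

abbreviation clinear_op :: "('h::complex_hilbert \<Rightarrow> 'h) \<Rightarrow> bool" where
  "clinear_op \<equiv> Vector_Spaces.linear scaleC scaleC"

definition compact_ops :: "('h::complex_hilbert \<Rightarrow> 'h) set" where
  "compact_ops = {a. clinear_op a \<and> compact (closure (a ` cball 0 1))}"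

definition positive_op :: "('h::complex_hilbert \<Rightarrow> 'h) \<Rightarrow> bool" where
  "positive_op a \<longleftrightarrow> clinear_op a \<and> bounded_linear a \<and> (\<forall>x. cinner (a x) x \<in> \<real>\<^sub>\<ge>\<^sub>0)"

definition cadjoint :: "('h::complex_hilbert \<Rightarrow> 'h) \<Rightarrow> 'h \<Rightarrow> 'h" where
  "cadjoint a = (THE b. \<forall>x y. cinner (a x) y = cinner x (b y))"

definition op_sqrt :: "('h::complex_hilbert \<Rightarrow> 'h) \<Rightarrow> 'h \<Rightarrow> 'h" where
  "op_sqrt b = (THE c. positive_op c \<and> c \<circ> c = b)"

definition op_abs :: "('h::complex_hilbert \<Rightarrow> 'h) \<Rightarrow> 'h \<Rightarrow> 'h" where
  "op_abs a = op_sqrt (cadjoint a \<circ> a)"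

definition eigenspace :: "('h::complex_hilbert \<Rightarrow> 'h) \<Rightarrow> complex \<Rightarrow> 'h set" where
  "eigenspace a t = {x. a x = t *\<^sub>C x}"

text \<open>
  For a positive compact operator \<open>a\<close>, \<open>eigval a n\<close> is \<open>\<lambda>\<^sub>n\<^sub>+\<^sub>1(a)\<close> (indices start at 0). It is the unique
  decreasing nonnegative sequence in which every \<open>t > 0\<close> occurs exactly as often as its multiplicity
  as an eigenvalue (0 times if it is not one); the remaining terms, if any, are 0.
\<close>

definition eigval :: "('h::complex_hilbert \<Rightarrow> 'h) \<Rightarrow> nat \<Rightarrow> real" where
  "eigval a = (THE l. decseq l \<and> (\<forall>n. 0 \<le> l n) \<and>
     (\<forall>t>0. finite {n. l n = t} \<and>
            card {n. l n = t} = cspace.dim (eigenspace a (complex_of_real t))))"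

text \<open>Because of the index shift, the \<open>n\<close>-th summand is
  \<open>(\<lambda>\<^sub>n\<^sub>+\<^sub>1(a) - \<lambda>\<^sub>n\<^sub>+\<^sub>2(a)) \<alpha>(n+1)\<close>.\<close>

definition choquet_trace :: "(nat \<Rightarrow> real) \<Rightarrow> ('h::complex_hilbert \<Rightarrow> 'h) \<Rightarrow> ennreal" where
  "choquet_trace \<alpha> a = (\<Sum>n. ennreal ((eigval a n - eigval a (Suc n)) * \<alpha> (Suc n)))"

definition choquet_norm :: "(nat \<Rightarrow> real) \<Rightarrow> ('h::complex_hilbert \<Rightarrow> 'h) \<Rightarrow> ennreal" where
  "choquet_norm \<alpha> a = choquet_trace \<alpha> (op_abs a)"

end

theory Submission
  imports Defs
begin

text \<open>
  A compact operator \<open>a\<close> has a singular value decomposition \<open>a x = (\<Sum>n. s n \<langle>x, e n\<rangle> f n)\<close>, found by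
  successively maximising \<open>norm (a x)\<close> over the unit ball of the orthogonal complement of the
  previous maximisers. Then \<open>s\<close> is the eigenvalue sequence of \<open>|a|\<close>, and Ky Fan's principle states
  that the sum of \<open>s n\<close> over \<open>n < k\<close> is the maximum of \<open>(\<Sum>j<k. Re \<langle>a (x j), y j\<rangle>)\<close> over orthonormal
  systems \<open>x\<close>, \<open>y\<close>, so it is subadditive in \<open>a\<close>. If the increments of \<open>\<alpha>\<close> decrease, summation by
  parts writes the Choquet norm as a nonnegative combination of these sums. Conversely, the
  triangle inequality for two rank \<open>i\<close> projections whose ranges share \<open>i - 1\<close> dimensions says
  \<open>\<alpha> (i - 1) + \<alpha> (i + 1) \<le> 2 * \<alpha> i\<close>.
\<close>

section \<open>Calculus of the complex inner product\<close>

instance complex_hilbert \<subseteq> banach ..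

lemma scaleR_scaleC: "r *\<^sub>R (x::'h::complex_hilbert) = complex_of_real r *\<^sub>C x"
  by (simp add: scaleC_of_real)

lemma cinner_add_right: "cinner x (y + z) = cinner x y + cinner x z"
  by (metis cinner_commute cinner_add_left complex_cnj_add)

lemma cinner_scaleC_right: "cinner x (c *\<^sub>C y) = cnj c * cinner x y"
  by (metis cinner_commute cinner_scaleC_left complex_cnj_mult)

lemma cinner_zero_left [simp]: "cinner 0 x = 0"
  by (metis add_cancel_left_left cinner_add_left)

lemma cinner_zero_right [simp]: "cinner x 0 = 0"
  by (metis add_cancel_left_left cinner_add_right)

lemma cinner_minus_left: "cinner (- x) y = - cinner x y"
  by (metis add.right_inverse add_eq_0_iff cinner_add_left cinner_zero_left)

lemma cinner_minus_right: "cinner x (- y) = - cinner x y"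
  by (metis add.right_inverse add_eq_0_iff cinner_add_right cinner_zero_right)

lemma cinner_diff_left: "cinner (x - y) z = cinner x z - cinner y z"
  using cinner_add_left [of x "- y" z] by (simp add: cinner_minus_left)

lemma cinner_diff_right: "cinner x (y - z) = cinner x y - cinner x z"
  using cinner_add_right [of x y "- z"] by (simp add: cinner_minus_right)

lemma cinner_sum_left: "cinner (sum g A) y = (\<Sum>i\<in>A. cinner (g i) y)"
  by (induction A rule: infinite_finite_induct) (simp_all add: cinner_add_left)

lemma cinner_sum_right: "cinner x (sum g A) = (\<Sum>i\<in>A. cinner x (g i))"
  by (induction A rule: infinite_finite_induct) (simp_all add: cinner_add_right)

lemma cinner_self: "cinner x x = complex_of_real ((norm x)\<^sup>2)"
proof (rule complex_eqI)
  show "Re (cinner x x) = Re (complex_of_real ((norm x)\<^sup>2))"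
    by (simp add: Re_cinner power2_norm_eq_inner)
  have "Im (cinner x x) = - Im (cinner x x)"
    by (metis cinner_commute cnj.simps(2))
  then show "Im (cinner x x) = Im (complex_of_real ((norm x)\<^sup>2))" by simp
qed

lemma norm_scaleC: "norm (c *\<^sub>C x) = cmod c * norm x"
proof -
  have "complex_of_real ((norm (c *\<^sub>C x))\<^sup>2) = (c * cnj c) * complex_of_real ((norm x)\<^sup>2)"
    by (simp only: cinner_self [symmetric] cinner_scaleC_left cinner_scaleC_right mult_ac)
  also have "\<dots> = complex_of_real ((cmod c * norm x)\<^sup>2)"
    by (simp add: complex_norm_square [symmetric] power_mult_distrib)
  finally have "(norm (c *\<^sub>C x))\<^sup>2 = (cmod c * norm x)\<^sup>2"
    using of_real_eq_iff by blast
  then show ?thesis by simp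
qed

lemma bounded_bilinear_cinner: "bounded_bilinear (cinner :: 'h::complex_hilbert \<Rightarrow> 'h \<Rightarrow> complex)"
proof
  fix x y z :: 'h and r :: real
  show "cinner (x + y) z = cinner x z + cinner y z" "cinner x (y + z) = cinner x y + cinner x z"
    by (rule cinner_add_left cinner_add_right)+
  show "cinner (r *\<^sub>R x) y = r *\<^sub>R cinner x y" "cinner x (r *\<^sub>R y) = r *\<^sub>R cinner x y"
    by (simp_all add: scaleR_scaleC cinner_scaleC_left cinner_scaleC_right scaleR_conv_of_real)
  have "norm (cinner x y) \<le> norm x * norm y * 2" for x y :: 'h
  proof -
    \<comment> \<open>The imaginary part is the real part after rotating \<open>x\<close> by
      \<open>- \<i>\<close>, so the real Cauchy-Schwarz inequality bounds both parts; adding the two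
      bounds gives the constant 2.\<close>
    have "Im (cinner x y) = Re (cinner ((- \<i>) *\<^sub>C x) y)"
      by (simp add: cinner_scaleC_left cinner_minus_left)
    then have "\<bar>Im (cinner x y)\<bar> \<le> norm ((- \<i>) *\<^sub>C x) * norm y"
      unfolding Re_cinner using Cauchy_Schwarz_ineq2 by metis
    then have "\<bar>Im (cinner x y)\<bar> \<le> norm x * norm y"
      by (simp add: norm_scaleC)
    moreover have "\<bar>Re (cinner x y)\<bar> \<le> norm x * norm y"
      unfolding Re_cinner by (rule Cauchy_Schwarz_ineq2)
    ultimately show ?thesis using cmod_le [of "cinner x y"] by linarith
  qed
  then show "\<exists>K. \<forall>x y::'h. norm (cinner x y) \<le> norm x * norm y * K" by blast
qed

lemma bounded_bilinear_scaleC: "bounded_bilinear (scaleC :: complex \<Rightarrow> 'h \<Rightarrow> 'h::complex_hilbert)"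
proof
  fix x y :: 'h and c d :: complex and r :: real
  show "(c + d) *\<^sub>C x = c *\<^sub>C x + d *\<^sub>C x" "c *\<^sub>C (x + y) = c *\<^sub>C x + c *\<^sub>C y"
    by (rule scaleC_add_left scaleC_add_right)+
  show "(r *\<^sub>R c) *\<^sub>C x = r *\<^sub>R (c *\<^sub>C x)" "c *\<^sub>C (r *\<^sub>R x) = r *\<^sub>R (c *\<^sub>C x)"
    by (simp_all add: scaleR_scaleC scaleR_conv_of_real scaleC_scaleC mult.commute)
  show "\<exists>K. \<forall>c. \<forall>x::'h. norm (c *\<^sub>C x) \<le> norm c * norm x * K"
    by (rule exI [of _ 1]) (simp add: norm_scaleC)
qed

lemma clinear_op_iff:
  "clinear_op a \<longleftrightarrow> (\<forall>x y. a (x + y) = a x + a y) \<and> (\<forall>c x. a (c *\<^sub>C x) = c *\<^sub>C a x)"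
  by (simp add: Vector_Spaces.linear_iff cspace.vector_space_axioms)

lemma clinear_opD:
  assumes "clinear_op a"
  shows "a (x + y) = a x + a y" "a (c *\<^sub>C x) = c *\<^sub>C a x" "a 0 = 0" "a (x - y) = a x - a y"
    "a (sum g A) = (\<Sum>i\<in>A. a (g i))" "a (r *\<^sub>R x) = r *\<^sub>R a x"
proof -
  interpret Vector_Spaces.linear scaleC scaleC a by fact
  show "a (x + y) = a x + a y" "a (c *\<^sub>C x) = c *\<^sub>C a x" "a 0 = 0" "a (x - y) = a x - a y"
    "a (sum g A) = (\<Sum>i\<in>A. a (g i))"
    by (simp_all add: add scale zero diff sum)
  show "a (r *\<^sub>R x) = r *\<^sub>R a x" by (simp add: scaleR_scaleC scale)
qed

section \<open>Orthonormal systems, orthogonal projections and Bessel's inequality\<close>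

text \<open>Zero vectors are admitted, so that finite systems can be indexed by \<^typ>\<open>nat\<close> as well.\<close>

definition ortho_sys :: "(nat \<Rightarrow> 'h::complex_hilbert) \<Rightarrow> bool" where
  "ortho_sys e \<longleftrightarrow> (\<forall>m n. m \<noteq> n \<longrightarrow> cinner (e m) (e n) = 0) \<and> (\<forall>n. norm (e n) = 1 \<or> e n = 0)"

lemma ortho_sysD:
  assumes "ortho_sys e"
  shows "m \<noteq> n \<Longrightarrow> cinner (e m) (e n) = 0" "norm (e n) = 1 \<or> e n = 0" "norm (e n) \<le> 1"
    "norm (e n) = 1 \<Longrightarrow> cinner (e n) (e n) = 1"
proof -
  show 1: "norm (e n) = 1 \<or> e n = 0" using assms by (simp add: ortho_sys_def)
  show "norm (e n) \<le> 1" using 1 by (elim disjE) simp_all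
qed (use assms in \<open>simp_all add: ortho_sys_def cinner_self\<close>)

lemma cinner_sum_ortho:
  assumes "ortho_sys e" "finite A" "m \<in> A"
  shows "cinner (\<Sum>n\<in>A. z n *\<^sub>C e n) (e m) = z m * cinner (e m) (e m)"
proof -
  have "cinner (\<Sum>n\<in>A. z n *\<^sub>C e n) (e m) = (\<Sum>n\<in>A. z n * cinner (e n) (e m))"
    by (simp add: cinner_sum_left cinner_scaleC_left)
  also have "\<dots> = (\<Sum>n\<in>A. if n = m then z m * cinner (e m) (e m) else 0)"
    by (rule sum.cong) (auto simp: ortho_sysD(1) [OF assms(1)])
  finally show ?thesis using assms by simp
qed

text \<open>Either \<open>e m\<close> is a unit vector and the second factor is 1, or
  \<open>e m = 0\<close> and both sides vanish.\<close>

lemma cinner_proj_self: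
  assumes "ortho_sys e"
  shows "cinner x (e m) * cinner (e m) (e m) = cinner x (e m)"
  using ortho_sysD(2,4) [OF assms, of m] by auto

lemma norm_sum_ortho:
  assumes "ortho_sys e" "finite A"
  shows "(norm (\<Sum>n\<in>A. z n *\<^sub>C e n))\<^sup>2 = (\<Sum>n\<in>A. (cmod (z n) * norm (e n))\<^sup>2)"
proof -
  have "complex_of_real ((norm (\<Sum>n\<in>A. z n *\<^sub>C e n))\<^sup>2)
      = (\<Sum>m\<in>A. cnj (z m) * cinner (\<Sum>n\<in>A. z n *\<^sub>C e n) (e m))"
    by (simp only: cinner_self [symmetric] cinner_sum_right cinner_scaleC_right)
  also have "\<dots> = (\<Sum>m\<in>A. complex_of_real ((cmod (z m) * norm (e m))\<^sup>2))"
  proof (rule sum.cong)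
    fix m assume "m \<in> A"
    have "cnj (z m) * cinner (\<Sum>n\<in>A. z n *\<^sub>C e n) (e m) = (z m * cnj (z m)) * cinner (e m) (e m)"
      unfolding cinner_sum_ortho [OF assms \<open>m \<in> A\<close>] by (simp only: mult_ac)
    also have "\<dots> = complex_of_real ((cmod (z m))\<^sup>2) * complex_of_real ((norm (e m))\<^sup>2)"
      by (simp only: complex_norm_square cinner_self)
    finally show "cnj (z m) * cinner (\<Sum>n\<in>A. z n *\<^sub>C e n) (e m) = complex_of_real ((cmod (z m) * norm (e m))\<^sup>2)"
      by (simp only: power_mult_distrib of_real_mult)
  qed simp
  finally show ?thesis by (simp only: of_real_sum [symmetric] of_real_eq_iff)
qed

text \<open>For an \<open>ortho_sys\<close> this is the orthogonal projection onto the complement of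
  the first \<open>N\<close> vectors.\<close>

definition proj_rest :: "(nat \<Rightarrow> 'h::complex_hilbert) \<Rightarrow> nat \<Rightarrow> 'h \<Rightarrow> 'h" where
  "proj_rest e N x = x - (\<Sum>n<N. cinner x (e n) *\<^sub>C e n)"

lemma cinner_proj_rest:
  assumes "ortho_sys e" "m < N"
  shows "cinner (proj_rest e N x) (e m) = 0"
  using assms cinner_sum_ortho [of e "{..<N}" m "\<lambda>n. cinner x (e n)"]
  by (simp add: proj_rest_def cinner_diff_left cinner_proj_self)

text \<open>Pythagoras for the splitting of \<open>x\<close> into its projection and the remainder.
  Zero vectors of the system contribute 0 to both sums.\<close>

lemma norm_proj_rest:
  assumes "ortho_sys e"
  shows "(norm (proj_rest e N x))\<^sup>2 + (\<Sum>n<N. (cmod (cinner x (e n)))\<^sup>2) = (norm x)\<^sup>2"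
proof -
  let ?P = "\<Sum>n<N. cinner x (e n) *\<^sub>C e n" and ?R = "proj_rest e N x"
  have "cinner ?R ?P = 0"
    by (simp add: cinner_sum_right cinner_scaleC_right cinner_proj_rest [OF assms])
  then have "inner ?R ?P = 0" by (metis Re_cinner zero_complex.simps(1))
  moreover have "x = ?R + ?P" by (simp add: proj_rest_def)
  ultimately have "(norm x)\<^sup>2 = (norm ?R)\<^sup>2 + (norm ?P)\<^sup>2"
    by (metis norm_add_Pythagorean orthogonal_def)
  also have "(norm ?P)\<^sup>2 = (\<Sum>n<N. (cmod (cinner x (e n)) * norm (e n))\<^sup>2)"
    by (rule norm_sum_ortho) (use assms in auto)
  also have "\<dots> = (\<Sum>n<N. (cmod (cinner x (e n)))\<^sup>2)"
  proof (rule sum.cong)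
    show "(cmod (cinner x (e n)) * norm (e n))\<^sup>2 = (cmod (cinner x (e n)))\<^sup>2" for n
      using ortho_sysD(2) [OF assms, of n] by (elim disjE) simp_all
  qed simp
  finally show ?thesis by simp
qed

lemma norm_proj_rest_le:
  assumes "ortho_sys e" shows "norm (proj_rest e N x) \<le> norm x"
proof (rule power2_le_imp_le)
  have "0 \<le> (\<Sum>n<N. (cmod (cinner x (e n)))\<^sup>2)" by (simp add: sum_nonneg)
  then show "(norm (proj_rest e N x))\<^sup>2 \<le> (norm x)\<^sup>2"
    using norm_proj_rest [OF assms, of N x] by linarith
qed simp

lemma bessel:
  assumes "ortho_sys e" "finite A"
  shows "(\<Sum>n\<in>A. (cmod (cinner x (e n)))\<^sup>2) \<le> (norm x)\<^sup>2"
proof -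
  obtain N where "A \<subseteq> {..<N}" using assms(2) finite_nat_iff_bounded by auto
  then have "(\<Sum>n\<in>A. (cmod (cinner x (e n)))\<^sup>2) \<le> (\<Sum>n<N. (cmod (cinner x (e n)))\<^sup>2)"
    by (intro sum_mono2) auto
  also have "\<dots> \<le> (norm x)\<^sup>2"
    using norm_proj_rest [OF assms(1), of N x] zero_le_power2 [of "norm (proj_rest e N x)"] by linarith
  finally show ?thesis .
qed

section \<open>Singular systems and singular value decompositions\<close>

text \<open>Unit length is demanded only where \<open>s n \<noteq> 0\<close>, so that operators of
  finite rank fit in as systems padded with zeros.\<close>

definition singular_sys :: "(nat \<Rightarrow> real) \<Rightarrow> (nat \<Rightarrow> 'h::complex_hilbert) \<Rightarrow> (nat \<Rightarrow> 'h) \<Rightarrow> bool" where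
  "singular_sys s e f \<longleftrightarrow> decseq s \<and> s \<longlonglongrightarrow> 0 \<and> ortho_sys e \<and> ortho_sys f \<and>
     (\<forall>n. s n \<noteq> 0 \<longrightarrow> norm (e n) = 1 \<and> norm (f n) = 1)"

definition svd :: "('h::complex_hilbert \<Rightarrow> 'h) \<Rightarrow> (nat \<Rightarrow> real) \<Rightarrow> (nat \<Rightarrow> 'h) \<Rightarrow> (nat \<Rightarrow> 'h) \<Rightarrow> bool" where
  "svd a s e f \<longleftrightarrow> singular_sys s e f \<and>
     (\<forall>x. (\<lambda>n. (complex_of_real (s n) * cinner x (e n)) *\<^sub>C f n) sums a x)"

lemma singular_sysD:
  assumes "singular_sys s e f"
  shows "decseq s" "s \<longlonglongrightarrow> 0" "ortho_sys e" "ortho_sys f" "s n \<noteq> 0 \<Longrightarrow> norm (e n) = 1"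
    "s n \<noteq> 0 \<Longrightarrow> norm (f n) = 1" "0 \<le> s n" "singular_sys s f e" "singular_sys s e e"
  using assms decseq_ge [of s 0 n] unfolding singular_sys_def by auto

lemma svdD:
  assumes "svd a s e f"
  shows "singular_sys s e f" "(\<lambda>n. (complex_of_real (s n) * cinner x (e n)) *\<^sub>C f n) sums a x"
  using assms unfolding svd_def by auto

text \<open>The terms are orthogonal, so Pythagoras and Bessel apply. An arbitrary finite
  \<open>A\<close> serves two purposes: blocks beyond \<open>N\<close> with \<open>r = s N\<close>
  give the Cauchy criterion, initial segments with \<open>r = s 0\<close> the operator
  bound.\<close>

lemma norm_partial_svd_le:
  assumes "singular_sys s e f" "finite A" "\<And>n. n \<in> A \<Longrightarrow> s n \<le> r" and r: "0 \<le> r"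
  shows "norm (\<Sum>n\<in>A. (complex_of_real (s n) * cinner x (e n)) *\<^sub>C f n) \<le> r * norm x"
proof -
  have "(norm (\<Sum>n\<in>A. (complex_of_real (s n) * cinner x (e n)) *\<^sub>C f n))\<^sup>2
      = (\<Sum>n\<in>A. (cmod (complex_of_real (s n) * cinner x (e n)) * norm (f n))\<^sup>2)"
    by (rule norm_sum_ortho) (use assms singular_sysD in auto)
  also have "\<dots> \<le> (\<Sum>n\<in>A. r\<^sup>2 * (cmod (cinner x (e n)))\<^sup>2)"
  proof (rule sum_mono)
    fix n assume "n \<in> A"
    have "cmod (complex_of_real (s n) * cinner x (e n)) * norm (f n) \<le> (r * cmod (cinner x (e n))) * 1"
      unfolding norm_mult
      by (intro mult_mono) (use \<open>n \<in> A\<close> r assms singular_sysD(7) [OF assms(1)] ortho_sysD(3) [OF singular_sysD(4) [OF assms(1)]] in auto)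
    then show "(cmod (complex_of_real (s n) * cinner x (e n)) * norm (f n))\<^sup>2 \<le> r\<^sup>2 * (cmod (cinner x (e n)))\<^sup>2"
      unfolding power_mult_distrib [of r, symmetric] by (intro power_mono) simp_all
  qed
  also have "\<dots> \<le> r\<^sup>2 * (norm x)\<^sup>2"
    unfolding sum_distrib_left [symmetric]
    by (intro mult_left_mono bessel) (use assms singular_sysD in auto)
  finally show ?thesis
    unfolding power_mult_distrib [symmetric] by (rule power2_le_imp_le) (simp add: r)
qed

lemma singular_sys_sums:
  assumes "singular_sys s e f"
  shows "summable (\<lambda>n. (complex_of_real (s n) * cinner x (e n)) *\<^sub>C f n)"
  unfolding summable_Cauchy
proof (intro allI impI)
  fix \<epsilon> :: real assume "0 < \<epsilon>"
  have "(\<lambda>n. s n * norm x) \<longlonglongrightarrow> 0 * norm x"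
    by (intro tendsto_intros singular_sysD [OF assms])
  then have "\<forall>\<^sub>F n in sequentially. s n * norm x < \<epsilon>"
    using \<open>0 < \<epsilon>\<close> by (simp add: order_tendstoD(2))
  then obtain N where N: "s N * norm x < \<epsilon>" by (auto simp: eventually_sequentially)
  have "norm (\<Sum>n\<in>{m..<k}. (complex_of_real (s n) * cinner x (e n)) *\<^sub>C f n) \<le> s N * norm x" if "m \<ge> N" for m k
    by (rule norm_partial_svd_le [OF assms])
      (use that singular_sysD(1) [OF assms] in \<open>auto simp: decseq_def singular_sysD(7) [OF assms]\<close>)
  then show "\<exists>N. \<forall>m\<ge>N. \<forall>k. norm (\<Sum>n\<in>{m..<k}. (complex_of_real (s n) * cinner x (e n)) *\<^sub>C f n) < \<epsilon>"
    using N by (meson le_less_trans)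
qed

lemma singular_sys_imp_svd:
  assumes "singular_sys s e f"
  obtains a where "svd a s e f"
  using that [of "\<lambda>x. \<Sum>n. (complex_of_real (s n) * cinner x (e n)) *\<^sub>C f n"] singular_sys_sums [OF assms] assms
  by (simp add: svd_def summable_sums)

lemma svd_norm_le:
  assumes "svd a s e f"
  shows "norm (a x) \<le> s 0 * norm x"
proof (rule LIMSEQ_le_const2)
  show "(\<lambda>N. norm (\<Sum>n<N. (complex_of_real (s n) * cinner x (e n)) *\<^sub>C f n)) \<longlonglongrightarrow> norm (a x)"
    using svdD(2) [OF assms] unfolding sums_def by (rule tendsto_norm)
  show "\<exists>M. \<forall>N\<ge>M. norm (\<Sum>n<N. (complex_of_real (s n) * cinner x (e n)) *\<^sub>C f n) \<le> s 0 * norm x"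
    using singular_sysD(1) [OF svdD(1) [OF assms]]
    by (intro exI allI impI norm_partial_svd_le [OF svdD(1) [OF assms]]) (auto simp: decseq_def singular_sysD(7) [OF svdD(1) [OF assms]])
qed

lemma sums_scaleC: "g sums x \<Longrightarrow> (\<lambda>n. c *\<^sub>C g n) sums (c *\<^sub>C x)"
  by (rule bounded_linear.sums [OF bounded_bilinear.bounded_linear_right [OF bounded_bilinear_scaleC]])

lemma sums_cinner_left: "g sums x \<Longrightarrow> (\<lambda>n. cinner (g n) y) sums cinner x y"
  by (rule bounded_linear.sums [OF bounded_bilinear.bounded_linear_left [OF bounded_bilinear_cinner]])

lemma sums_cinner_right: "g sums x \<Longrightarrow> (\<lambda>n. cinner y (g n)) sums cinner y x"
  by (rule bounded_linear.sums [OF bounded_bilinear.bounded_linear_right [OF bounded_bilinear_cinner]])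

lemma svd_clinear:
  assumes "svd a s e f"
  shows "clinear_op a"
proof -
  note S = svdD(2) [OF assms]
  have "a (x + y) = a x + a y" for x y
    using sums_add [OF S [of x] S [of y]] S [of "x + y"]
    by (auto simp: cinner_add_left scaleC_add_left distrib_left dest: sums_unique2)
  moreover have "a (c *\<^sub>C x) = c *\<^sub>C a x" for c x
    using sums_scaleC [OF S [of x], of c] S [of "c *\<^sub>C x"]
    by (auto simp: cinner_scaleC_left scaleC_scaleC mult_ac dest: sums_unique2)
  ultimately show ?thesis by (simp add: clinear_op_iff)
qed

lemma svd_bounded_linear:
  assumes "svd a s e f"
  shows "bounded_linear a"
  using clinear_opD [OF svd_clinear [OF assms]] svd_norm_le [OF assms]
  by (intro bounded_linear_intro [where K = "s 0"]) (auto simp: mult.commute)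

text \<open>Exchanging \<open>e\<close> and \<open>f\<close> gives the adjoint, because both inner
  products expand into the same series.\<close>

lemma svd_adjoint:
  assumes "svd a s e f" "svd b s f e"
  shows "cinner (a x) y = cinner x (b y)"
proof -
  have "(\<lambda>n. complex_of_real (s n) * cinner x (e n) * cinner (f n) y) sums cinner (a x) y"
    using sums_cinner_left [OF svdD(2) [OF assms(1)]] by (simp add: cinner_scaleC_left)
  moreover have "(\<lambda>n. complex_of_real (s n) * cinner x (e n) * cinner (f n) y) sums cinner x (b y)"
    using sums_cinner_right [OF svdD(2) [OF assms(2)], of x y]
    by (simp add: cinner_scaleC_right mult_ac cinner_commute [symmetric])
  ultimately show ?thesis by (rule sums_unique2)
qed

lemma svd_apply:
  assumes "svd a s e f"
  shows "a (e m) = complex_of_real (s m) *\<^sub>C f m"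
proof -
  note D = singular_sysD [OF svdD(1) [OF assms]]
  have "(\<lambda>n. (complex_of_real (s n) * cinner (e m) (e n)) *\<^sub>C f n)
      = (\<lambda>n. if n = m then complex_of_real (s m) *\<^sub>C f m else 0)"
    using ortho_sysD(1,4) [OF D(3)] D(5) by (auto simp: fun_eq_iff) 
  then have "(\<lambda>n. (complex_of_real (s n) * cinner (e m) (e n)) *\<^sub>C f n) sums (complex_of_real (s m) *\<^sub>C f m)"
    using sums_single [of m "\<lambda>_. complex_of_real (s m) *\<^sub>C f m"] by simp
  then show ?thesis
    using svdD(2) [OF assms, of "e m"] sums_unique2 by blast
qed

text \<open>\<open>b\<close> is the adjoint of \<open>a\<close>, so the right-hand side depends on \<open>s\<close> and \<open>e\<close> only.\<close>

lemma svd_adjoint_comp: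
  assumes "svd a s e f" "svd b s f e"
  shows "(\<lambda>n. (complex_of_real ((s n)\<^sup>2) * cinner x (e n)) *\<^sub>C e n) sums b (a x)"
proof -
  have "cinner (a x) (f n) = complex_of_real (s n) * cinner x (e n)" for n
    using svd_adjoint [OF assms, of x "f n"] svd_apply [OF assms(2), of n] by (simp add: cinner_scaleC_right)
  then show ?thesis using svdD(2) [OF assms(2), of "a x"] by (simp add: power2_eq_square mult_ac)
qed

section \<open>Adjoints, positive operators and the absolute value\<close>

text \<open>Two candidates differ at \<open>y\<close> by a vector orthogonal to itself, so the
  definite description is determined.\<close>

lemma cadjoint_eqI:
  assumes "\<And>x y. cinner (a x) y = cinner x (b y)"
  shows "cadjoint a = b"
  unfolding cadjoint_def
proof (rule the_equality)
  fix b' assume b': "\<forall>x y. cinner (a x) y = cinner x (b' y)"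
  have "cinner (b' y - b y) (b' y - b y) = 0" for y
    using assms b' by (simp add: cinner_diff_right)
  then have "b' y = b y" for y by (simp add: cinner_self)
  then show "b' = b" by blast
qed (use assms in blast)

lemma positive_opD:
  assumes "positive_op c"
  shows "clinear_op c" "cinner (c x) y = cinner x (c y)" "0 \<le> Re (cinner (c x) x)"
proof -
  show lin: "clinear_op c" using assms by (simp add: positive_op_def)
  have R: "cinner (c x) x \<in> \<real>\<^sub>\<ge>\<^sub>0" for x using assms by (simp add: positive_op_def)
  show "0 \<le> Re (cinner (c x) x)" using R [of x] by (simp add: complex_nonneg_Reals_iff)
  have I: "Im (cinner (c x) x) = 0" for x using R [of x] by (simp add: complex_nonneg_Reals_iff)
  \<comment> \<open>Polarisation: the quadratic form is real at \<open>x\<close>, \<open>y\<close>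
    and \<open>x + y\<close>.\<close>
  have 1: "Im (cinner (c x) y) + Im (cinner (c y) x) = 0" for x y
    using I [of "x + y"] I [of x] I [of y] by (simp add: clinear_opD(1) [OF lin] cinner_add_left cinner_add_right)
  \<comment> \<open>Replacing \<open>x\<close> by \<open>\<i> *\<^sub>C x\<close> turns the
    statement on imaginary parts into one on real parts.\<close>
  have 2: "Re (cinner (c x) y) = Re (cinner (c y) x)"
    using 1 [of "\<i> *\<^sub>C x" y] by (simp add: clinear_opD(2) [OF lin] cinner_scaleC_left cinner_scaleC_right)
  have "cinner (c x) y = cnj (cinner (c y) x)"
    using 1 [of x y] 2 by (simp add: complex_eq_iff)
  then show "cinner (c x) y = cinner x (c y)" by (metis cinner_commute)
qed

lemma svd_positive:
  assumes "svd p s e e"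
  shows "positive_op p"
proof -
  have "cinner (p x) x \<in> \<real>\<^sub>\<ge>\<^sub>0" for x
  proof -
    have "(\<lambda>n. complex_of_real (s n) * (cinner x (e n) * cinner (e n) x)) sums cinner (p x) x"
      using sums_cinner_left [OF svdD(2) [OF assms], of x x] by (simp add: cinner_scaleC_left mult_ac)
    moreover have "cinner x (e n) * cinner (e n) x = complex_of_real ((cmod (cinner x (e n)))\<^sup>2)" for n
      unfolding cinner_commute [of "e n" x] by (rule complex_norm_square [symmetric])
    ultimately have S: "(\<lambda>n. complex_of_real (s n * (cmod (cinner x (e n)))\<^sup>2)) sums cinner (p x) x"
      by simp
    have "(\<lambda>n. s n * (cmod (cinner x (e n)))\<^sup>2) sums Re (cinner (p x) x)"
      using sums_Re [OF S] by simp
    then have "0 \<le> Re (cinner (p x) x)"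
      by (rule sums_le [OF _ sums_zero, rotated]) (simp add: singular_sysD(7) [OF svdD(1) [OF assms]])
    moreover have "(\<lambda>n. 0) sums Im (cinner (p x) x)" using sums_Im [OF S] by simp
    then have "Im (cinner (p x) x) = 0" using sums_unique2 sums_zero by blast
    ultimately show ?thesis by (simp add: complex_nonneg_Reals_iff)
  qed
  then show ?thesis using svd_clinear [OF assms] svd_bounded_linear [OF assms] by (simp add: positive_op_def)
qed

text \<open>The system \<open>e\<close> may fail to be complete, so the vectors
  \<open>proj_rest e N x\<close> need not tend to 0. Their images do, being the remainders of the
  series for \<open>a x\<close>.\<close>

lemma svd_proj_rest_tendsto:
  assumes "svd a s e f"
  shows "(\<lambda>N. a (proj_rest e N x)) \<longlonglongrightarrow> 0"
proof -
  note lin = clinear_opD [OF svd_clinear [OF assms]]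
  have "(\<lambda>N. a x - (\<Sum>n<N. (complex_of_real (s n) * cinner x (e n)) *\<^sub>C f n)) \<longlonglongrightarrow> a x - a x"
    using svdD(2) [OF assms, of x] unfolding sums_def by (intro tendsto_intros)
  then show ?thesis
    by (simp add: proj_rest_def lin svd_apply [OF assms] scaleC_scaleC mult.commute)
qed

lemma positive_square_norm:
  assumes "positive_op c"
  shows "(norm (c x))\<^sup>2 = Re (cinner (c (c x)) x)"
  using positive_opD(2) [OF assms, of "c x" x] by (simp add: cinner_self)

text \<open>Equal squares give \<open>norm (c x) = norm (p x)\<close>. The two operators agree on
  every \<open>e n\<close>, and on the remainders \<open>proj_rest e N x\<close> both tend to
  0.\<close>

lemma positive_root_unique:
  assumes p: "svd p s e e" and c: "positive_op c" and eq: "\<And>x. c (c x) = p (p x)"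
  shows "c = p"
proof
  fix x
  note lc = clinear_opD [OF positive_opD(1) [OF c]] and lp = clinear_opD [OF svd_clinear [OF p]]
  have norm_eq: "norm (c x) = norm (p x)" for x
    using positive_square_norm [OF c, of x] positive_square_norm [OF svd_positive [OF p], of x] eq
    by (simp add: power2_eq_iff_nonneg [symmetric])
  have ce: "c (e n) = p (e n)" for n
  proof (cases "s n = 0")
    case True
    then show ?thesis using norm_eq [of "e n"] svd_apply [OF p, of n] by simp
  next
    case False
    then have s: "s n > 0" using singular_sysD(7) [OF svdD(1) [OF p], of n] by simp
    \<comment> \<open>Since \<open>c\<close> and \<open>p\<close> have the same square, (c + s n)(c
      - s n) kills \<open>e n\<close>. Thus \<open>c z = - s n z\<close>, and positivity of
      \<open>c\<close> with \<open>s n > 0\<close> leaves only \<open>z = 0\<close>.\<close>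
    define z where "z = c (e n) - complex_of_real (s n) *\<^sub>C e n"
    have "c z + complex_of_real (s n) *\<^sub>C z = 0"
      by (simp add: z_def lc eq svd_apply [OF p] lp scaleC_scaleC cspace.scale_right_diff_distrib)
    then have "cinner (c z + complex_of_real (s n) *\<^sub>C z) z = 0" by simp
    then have "Re (cinner (c z) z) + s n * (norm z)\<^sup>2 = 0"
      by (auto simp: cinner_add_left cinner_scaleC_left cinner_self complex_eq_iff)
    then have "s n * (norm z)\<^sup>2 \<le> 0" using positive_opD(3) [OF c, of z] by linarith
    then have "z = 0" using s by (simp add: mult_le_0_iff)
    then show ?thesis by (simp add: z_def svd_apply [OF p])
  qed
  have "(\<lambda>N. norm (p (proj_rest e N x))) \<longlonglongrightarrow> 0"
    using svd_proj_rest_tendsto [OF p] tendsto_norm_zero by blast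
  then have "(\<lambda>N. c (proj_rest e N x) - p (proj_rest e N x)) \<longlonglongrightarrow> 0 - 0"
    by (intro tendsto_diff svd_proj_rest_tendsto [OF p]) (simp add: norm_eq [symmetric] tendsto_norm_zero_iff)
  \<comment> \<open>The difference does not depend on \<open>N\<close>, so its limit 0 is its
    value.\<close>
  moreover have "c (proj_rest e N x) - p (proj_rest e N x) = c x - p x" for N
    by (simp add: proj_rest_def lc lp ce)
  ultimately show "c x = p x" by (simp add: LIMSEQ_const_iff)
qed

text \<open>With \<open>b\<close> the adjoint of \<open>a\<close>, both \<open>b \<circ> a\<close>
  and the square of the positive operator \<open>p\<close> have the expansion with weights
  \<open>(s n)\<^sup>2\<close> along \<open>e\<close>; uniqueness of the positive root then
  identifies \<open>p\<close> with \<open>op_abs a\<close>.\<close>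

lemma svd_op_abs:
  assumes "svd a s e f"
  shows "svd (op_abs a) s e e"
proof -
  note S = svdD(1) [OF assms]
  obtain b where b: "svd b s f e" using singular_sys_imp_svd [OF singular_sysD(8) [OF S]] .
  obtain p where p: "svd p s e e" using singular_sys_imp_svd [OF singular_sysD(9) [OF S]] .
  have pp: "p (p x) = b (a x)" for x
    using svd_adjoint_comp [OF assms b, of x] svd_adjoint_comp [OF p p, of x] sums_unique2 by blast
  have "cadjoint a = b" by (rule cadjoint_eqI) (rule svd_adjoint [OF assms b])
  have "op_abs a = p"
    unfolding op_abs_def op_sqrt_def \<open>cadjoint a = b\<close>
  proof (intro the_equality conjI svd_positive [OF p])
    show "p \<circ> p = b \<circ> a" by (simp add: fun_eq_iff pp)
    fix c assume c: "positive_op c \<and> c \<circ> c = b \<circ> a"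
    then have "c (c x) = p (p x)" for x by (metis comp_apply pp)
    then show "c = p" using positive_root_unique [OF p] c by blast
  qed
  then show ?thesis using p by simp
qed

section \<open>Basic properties of compact operators\<close>

lemma compact_ops_bounded:
  assumes "a \<in> compact_ops"
  shows "\<exists>B. \<forall>x. norm (a x) \<le> B * norm x"
proof -
  have "bounded (a ` cball 0 1)"
    using assms compact_imp_bounded bounded_subset closure_subset unfolding compact_ops_def by blast
  then obtain B where "\<forall>y\<in>a ` cball 0 1. norm y \<le> B"
    by (auto simp: bounded_iff)
  then have B: "norm (a x) \<le> B" if "norm x \<le> 1" for x using that by simp
  have lin: "clinear_op a" using assms by (simp add: compact_ops_def)
  have "norm (a x) \<le> B * norm x" for x
  proof (cases "x = 0")
    case True
    then show ?thesis by (simp add: clinear_opD(3) [OF lin])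
  next
    case False
    then have "norm (a ((1 / norm x) *\<^sub>R x)) \<le> B" by (intro B) simp
    then show ?thesis using False by (simp add: clinear_opD(6) [OF lin] field_simps)
  qed
  then show ?thesis by blast
qed

lemma compact_ops_bounded_linear:
  assumes "a \<in> compact_ops"
  shows "bounded_linear a"
proof -
  obtain B where "\<And>x. norm (a x) \<le> B * norm x" using compact_ops_bounded [OF assms] by blast
  moreover have "clinear_op a" using assms by (simp add: compact_ops_def)
  ultimately show ?thesis
    by (intro bounded_linear_intro [where K = B]) (auto simp: clinear_opD mult.commute)
qed

lemma compact_ops_subseq:
  assumes "a \<in> compact_ops" "\<And>n::nat. norm (x n) \<le> 1"
  obtains r y where "strict_mono r" "(\<lambda>n. a (x (r n))) \<longlonglongrightarrow> y"
proof -
  have "a (x n) \<in> closure (a ` cball 0 1)" for n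
    using assms(2) [of n] closure_subset by (auto intro!: subsetD [OF closure_subset] imageI)
  moreover have "seq_compact (closure (a ` cball 0 1))"
    using assms(1) compact_imp_seq_compact by (auto simp: compact_ops_def)
  ultimately obtain r y where "strict_mono r" "((\<lambda>n. a (x n)) \<circ> r) \<longlonglongrightarrow> y"
    using seq_compactE [of "closure (a ` cball 0 1)" "\<lambda>n. a (x n)"] by metis
  then show ?thesis using that by (simp add: comp_def)
qed

lemma compact_closure_subset:
  fixes K :: "'a::t2_space set"
  assumes "compact K" "S \<subseteq> K"
  shows "compact (closure S)"
proof -
  have "closure S \<subseteq> K" using assms by (intro closure_minimal compact_imp_closed)
  then have "K \<inter> closure S = closure S" by blast
  then show ?thesis using compact_Int_closed [OF assms(1) closed_closure, of S] by simp
qed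

text \<open>The image of the ball lies in the sum of two compact sets, which is compact.\<close>

lemma compact_ops_add:
  assumes "a \<in> compact_ops" "b \<in> compact_ops"
  shows "(\<lambda>x. a x + b x) \<in> compact_ops"
proof -
  let ?A = "closure (a ` cball 0 1)" and ?B = "closure (b ` cball 0 1)"
  let ?S = "{x + y | x y. x \<in> ?A \<and> y \<in> ?B}"
  have lin: "clinear_op a" "clinear_op b" and cpt: "compact ?A" "compact ?B"
    using assms by (simp_all add: compact_ops_def)
  have S: "compact ?S" by (rule compact_sums [OF cpt])
  have "(\<lambda>x. a x + b x) ` cball 0 1 \<subseteq> ?S"
    using closure_subset [of "a ` cball 0 1"] closure_subset [of "b ` cball 0 1"] by blast
  then have "compact (closure ((\<lambda>x. a x + b x) ` cball 0 1))"
    by (rule compact_closure_subset [OF S])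
  then show ?thesis
    using lin by (simp add: compact_ops_def clinear_op_iff scaleC_add_right)
qed

section \<open>Existence of the singular value decomposition\<close>

text \<open>A maximising sequence \<open>u\<close> is Cauchy: \<open>a\<close> maps \<open>u m\<close> and \<open>u l\<close> close to the same vector, so
  \<open>norm (u m + u l)\<close> is almost 2 and the parallelogram law applies. No adjoint is needed.\<close>

lemma maximising_Cauchy:
  fixes u :: "nat \<Rightarrow> 'h::complex_hilbert"
  assumes "clinear_op a" "0 < s" "norm y = s" "(\<lambda>n. a (u n)) \<longlonglongrightarrow> y" "\<And>n. norm (u n) \<le> 1"
    and max: "\<And>m n. norm (a (u m + u n)) \<le> s * norm (u m + u n)"
  shows "Cauchy u"
proof (rule metric_CauchyI)
  fix \<epsilon> :: real assume "0 < \<epsilon>"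
  \<comment> \<open>The parallelogram law will leave \<open>4 - (2 - 2 * \<delta>)\<^sup>2\<close>,
    which is at most \<open>8 * \<delta>\<close>; the bound \<open>\<delta> \<le> 1\<close> keeps
    \<open>2 - 2 * \<delta>\<close> nonnegative for squaring.\<close>
  define \<delta> where "\<delta> = min (\<epsilon>\<^sup>2 / 8) 1"
  have \<delta>: "0 < \<delta>" "\<delta> \<le> 1" "8 * \<delta> \<le> \<epsilon>\<^sup>2" using \<open>0 < \<epsilon>\<close> by (auto simp: \<delta>_def)
  obtain N where N: "\<And>n. n \<ge> N \<Longrightarrow> norm (a (u n) - y) < \<delta> * s"
    using LIMSEQ_D [OF assms(4), of "\<delta> * s"] \<delta> assms(2) by auto
  have "dist (u m) (u n) < \<epsilon>" if "m \<ge> N" "n \<ge> N" for m n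
  proof -
    have "2 * s = norm (2 *\<^sub>R y)" using assms(3) by simp
    also have "2 *\<^sub>R y = a (u m + u n) - (a (u m) - y) - (a (u n) - y)"
      by (simp add: clinear_opD [OF assms(1)] scaleR_2)
    also have "norm \<dots> \<le> norm (a (u m + u n)) + norm (a (u m) - y) + norm (a (u n) - y)"
      by (meson add_right_mono norm_triangle_ineq4 order_trans)
    also have "\<dots> < s * norm (u m + u n) + \<delta> * s + \<delta> * s"
      using max [of m n] N [OF that(1)] N [OF that(2)] by linarith
    finally have "s * 2 < s * (norm (u m + u n) + 2 * \<delta>)" by (simp add: algebra_simps)
    then have "2 - 2 * \<delta> < norm (u m + u n)" using assms(2) by (simp add: mult_less_cancel_left_pos)
    then have "(2 - 2 * \<delta>)\<^sup>2 < (norm (u m + u n))\<^sup>2" using \<delta> by (intro power_strict_mono) auto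
    moreover have "(norm (u m - u n))\<^sup>2 + (norm (u m + u n))\<^sup>2 = 2 * (norm (u m))\<^sup>2 + 2 * (norm (u n))\<^sup>2"
      by (simp add: power2_norm_eq_inner inner_add inner_diff inner_commute)
    moreover have "(norm (u m))\<^sup>2 \<le> 1" "(norm (u n))\<^sup>2 \<le> 1"
      using assms(5) by (simp_all add: power_le_one)
    ultimately have "(norm (u m - u n))\<^sup>2 < 4 - (2 - 2 * \<delta>)\<^sup>2" by linarith
    also have "\<dots> = 8 * \<delta> - 4 * \<delta>\<^sup>2" by (simp add: power2_eq_square algebra_simps)
    also have "\<dots> \<le> \<epsilon>\<^sup>2" using \<delta> zero_le_power2 [of \<delta>] by linarith
    finally show ?thesis using \<open>0 < \<epsilon>\<close> by (simp add: dist_norm power_less_imp_less_base)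
  qed
  then show "\<exists>M. \<forall>m\<ge>M. \<forall>n\<ge>M. dist (u m) (u n) < \<epsilon>" by blast
qed

text \<open>A maximising sequence has a subsequence with convergent images, and this subsequence is
  itself Cauchy; its limit is the maximiser. The last clause selects \<open>e = 0\<close> once
  \<open>a\<close> vanishes on the complement of \<open>A\<close>, so the recursive choice can go on
  forever.\<close>

lemma compact_ops_attains_norm:
  fixes A :: "'h::complex_hilbert set"
  assumes "a \<in> compact_ops"
  shows "\<exists>e. norm e \<le> 1 \<and> (\<forall>y\<in>A. cinner e y = 0) \<and>
    (\<forall>z. (\<forall>y\<in>A. cinner z y = 0) \<longrightarrow> norm (a z) \<le> norm (a e) * norm z) \<and> (a e = 0 \<longrightarrow> e = 0)"
proof -
  have lin: "clinear_op a" using assms by (simp add: compact_ops_def)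
  note L = clinear_opD [OF lin]
  define V where "V = {x. \<forall>y\<in>A. cinner x y = 0}"
  have V: "0 \<in> V" "\<And>x y. x \<in> V \<Longrightarrow> y \<in> V \<Longrightarrow> x + y \<in> V" "\<And>r x. x \<in> V \<Longrightarrow> r *\<^sub>R x \<in> V"
    by (auto simp: V_def cinner_add_left scaleR_scaleC cinner_scaleC_left)
  define F where "F = (\<lambda>x. norm (a x)) ` (V \<inter> cball 0 1)"
  define s where "s = Sup F"
  obtain B where B: "\<And>x. norm (a x) \<le> B * norm x" using compact_ops_bounded [OF assms] by blast
  have "norm (a x) \<le> \<bar>B\<bar>" if "norm x \<le> 1" for x
  proof -
    have "B * norm x \<le> \<bar>B\<bar> * 1" by (rule mult_mono) (use that in auto)
    then show ?thesis using B [of x] by linarith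
  qed
  then have bdd: "bdd_above F" by (auto simp: F_def intro!: bdd_aboveI2 [of _ _ "\<bar>B\<bar>"])
  have "0 \<in> F" using V(1) by (force simp: F_def L)
  have le: "norm (a x) \<le> s" if "x \<in> V" "norm x \<le> 1" for x
    unfolding s_def by (rule cSup_upper [OF _ bdd]) (use that in \<open>auto simp: F_def\<close>)
  have max: "norm (a z) \<le> s * norm z" if "z \<in> V" for z
  proof (cases "z = 0")
    case False
    then have "norm (a ((1 / norm z) *\<^sub>R z)) \<le> s" by (intro le V that) simp
    then show ?thesis using False by (simp add: L field_simps)
  qed (simp add: L)
  show ?thesis
  proof (cases "s = 0")
    case True
    then have "a z = 0" if "z \<in> V" for z using max [OF that] by simp
    then show ?thesis using V(1) by (intro exI [of _ 0]) (auto simp: L V_def)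
  next
    case False
    moreover have "0 \<le> s" unfolding s_def by (rule cSup_upper [OF \<open>0 \<in> F\<close> bdd])
    ultimately have "0 < s" by simp
    have "\<exists>x. x \<in> V \<and> norm x \<le> 1 \<and> s - 1 / Suc n < norm (a x)" for n :: nat
    proof -
      have "s - 1 / Suc n < Sup F" by (simp add: s_def)
      then obtain v where "v \<in> F" "s - 1 / Suc n < v"
        using less_cSup_iff [OF _ bdd] \<open>0 \<in> F\<close> by blast
      then show ?thesis by (auto simp: F_def)
    qed
    then obtain x where x: "\<And>n. x n \<in> V" "\<And>n. norm (x n) \<le> 1" "\<And>n::nat. s - 1 / Suc n < norm (a (x n))"
      by metis
    obtain r y where r: "strict_mono r" and y: "(\<lambda>n. a (x (r n))) \<longlonglongrightarrow> y"
      using compact_ops_subseq [OF assms x(2)] .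
    have "(\<lambda>n. norm (a (x n))) \<longlonglongrightarrow> s"
    proof (rule tendsto_sandwich)
      show "\<forall>\<^sub>F n in sequentially. s - 1 / Suc n \<le> norm (a (x n))"
        using x(3) less_imp_le by (intro always_eventually) blast
      show "\<forall>\<^sub>F n in sequentially. norm (a (x n)) \<le> s" using le x by simp
      show "(\<lambda>n. s - 1 / real (Suc n)) \<longlonglongrightarrow> s"
        using tendsto_diff [OF tendsto_const LIMSEQ_inverse_real_of_nat, of s] by (simp add: inverse_eq_divide)
    qed simp
    then have "(\<lambda>n. norm (a (x (r n)))) \<longlonglongrightarrow> s" using LIMSEQ_subseq_LIMSEQ [OF _ r] by (simp add: comp_def)
    then have "norm y = s" using tendsto_norm [OF y] LIMSEQ_unique by blast
    have "Cauchy (\<lambda>n. x (r n))"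
      by (rule maximising_Cauchy [OF lin \<open>0 < s\<close> \<open>norm y = s\<close> y]) (use x max V in auto)
    then obtain e where e: "(\<lambda>n. x (r n)) \<longlonglongrightarrow> e" using Cauchy_convergent_iff convergent_def by blast
    have "(\<lambda>n. a (x (r n))) \<longlonglongrightarrow> a e"
      by (rule bounded_linear.tendsto [OF compact_ops_bounded_linear [OF assms] e])
    then have ae: "norm (a e) = s" using y LIMSEQ_unique \<open>norm y = s\<close> by blast
    have "norm e \<le> 1" using x(2) by (intro LIMSEQ_le_const2 [OF tendsto_norm [OF e]]) auto
    moreover have "cinner e y = 0" if "y \<in> A" for y
    proof -
      have "(\<lambda>n. cinner (x (r n)) y) \<longlonglongrightarrow> cinner e y"
        by (rule bounded_bilinear.tendsto [OF bounded_bilinear_cinner e tendsto_const])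
      moreover have "(\<lambda>n. cinner (x (r n)) y) = (\<lambda>n. 0)" using x(1) that by (auto simp: V_def)
      ultimately show ?thesis by (simp add: LIMSEQ_const_iff)
    qed
    ultimately show ?thesis
      using max ae \<open>0 < s\<close> by (intro exI [of _ e]) (auto simp: V_def)
  qed
qed

text \<open>First variation: comparing \<open>e\<close> with \<open>e + r *\<^sub>R x\<close> bounds
  a term linear in \<open>r\<close> by a quadratic one, for all real \<open>r\<close>, so the linear
  coefficient vanishes. Hence \<open>a\<close> preserves orthogonality to the maximiser within the
  complement of \<open>A\<close>.\<close>

lemma maximiser_orthogonal:
  assumes lin: "clinear_op a"
    and max: "\<And>z. (\<forall>y\<in>A. cinner z y = 0) \<Longrightarrow> norm (a z) \<le> norm (a e) * norm z"
    and e: "\<forall>y\<in>A. cinner e y = 0" "norm e \<le> 1" and x: "\<forall>y\<in>A. cinner x y = 0" "cinner x e = 0"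
  shows "cinner (a x) (a e) = 0"
proof -
  note L = clinear_opD [OF lin]
  have *: "inner (a x) (a e) = 0" if x: "\<forall>y\<in>A. cinner x y = 0" "cinner x e = 0" for x
  proof -
    define R where "R = inner (a x) (a e)"
    define K where "K = (norm (a e) * norm x)\<^sup>2"
    have ex: "inner x e = 0" using x(2) by (metis Re_cinner zero_complex.simps(1))
    have R: "2 * r * R \<le> r\<^sup>2 * K" for r
    proof -
      have "norm (a (e + r *\<^sub>R x)) \<le> norm (a e) * norm (e + r *\<^sub>R x)"
        by (rule max) (use x e in \<open>simp add: cinner_add_left scaleR_scaleC cinner_scaleC_left\<close>)
      then have "(norm (a (e + r *\<^sub>R x)))\<^sup>2 \<le> (norm (a e))\<^sup>2 * (norm (e + r *\<^sub>R x))\<^sup>2"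
        unfolding power_mult_distrib [symmetric] by (intro power_mono) auto
      moreover have "(norm (a (e + r *\<^sub>R x)))\<^sup>2 = (norm (a e))\<^sup>2 + 2 * r * R + r\<^sup>2 * (norm (a x))\<^sup>2"
        unfolding power2_norm_eq_inner R_def
        by (simp add: L inner_add inner_commute power2_eq_square algebra_simps)
      moreover have *: "(norm (e + r *\<^sub>R x))\<^sup>2 = (norm e)\<^sup>2 + r\<^sup>2 * (norm x)\<^sup>2"
        unfolding power2_norm_eq_inner
        using ex by (simp add: inner_add inner_commute power2_eq_square algebra_simps)
      moreover have "(norm (a e))\<^sup>2 * (norm e)\<^sup>2 \<le> (norm (a e))\<^sup>2"
        using e(2) by (simp add: mult_left_le power_le_one)
      moreover have "0 \<le> r\<^sup>2 * (norm (a x))\<^sup>2" by simp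
      moreover have "(norm (a e))\<^sup>2 * (norm (e + r *\<^sub>R x))\<^sup>2 = (norm (a e))\<^sup>2 * (norm e)\<^sup>2 + r\<^sup>2 * K"
        unfolding * by (simp add: K_def power_mult_distrib algebra_simps)
      ultimately show ?thesis by linarith
    qed
    have K: "0 \<le> K" by (simp add: K_def)
    \<comment> \<open>For this \<open>r\<close> the inequality
      \<open>2 * r * R \<le> r\<^sup>2 * K\<close> leaves \<open>r\<^sup>2 \<le> 0\<close>; the
      summand 1 avoids division by zero.\<close>
    define r where "r = R / (K + 1)"
    have r: "R = r * (K + 1)" using K by (simp add: r_def)
    have "2 * r * R = 2 * (r\<^sup>2 * K) + 2 * r\<^sup>2" unfolding r by (simp add: power2_eq_square algebra_simps)
    moreover have "0 \<le> r\<^sup>2 * K" using K by simp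
    ultimately have "r\<^sup>2 \<le> 0" using R [of r] by linarith
    then have "R = 0" by (simp add: r)
    then show ?thesis by (simp add: R_def)
  qed
  \<comment> \<open>Rotating \<open>x\<close> by \<open>\<i>\<close> covers the imaginary part of
    the complex inner product.\<close>
  have "inner (a (\<i> *\<^sub>C x)) (a e) = 0"
    by (rule *) (use x in \<open>simp_all add: cinner_scaleC_left\<close>)
  then have "Im (cinner (a x) (a e)) = 0"
    by (simp add: Re_cinner [symmetric] L cinner_scaleC_left)
  moreover have "Re (cinner (a x) (a e)) = 0" using * [OF x] by (simp add: Re_cinner)
  ultimately show ?thesis by (simp add: complex_eq_iff)
qed

lemma compact_ops_svd:
  assumes "a \<in> compact_ops"
  obtains s e f where "svd a s e f"
proof -
  have lin: "clinear_op a" using assms by (simp add: compact_ops_def)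
  note L = clinear_opD [OF lin]
  define P where "P = (\<lambda>A e. norm e \<le> 1 \<and> (\<forall>y\<in>A. cinner e y = 0) \<and>
    (\<forall>z. (\<forall>y\<in>A. cinner z y = 0) \<longrightarrow> norm (a z) \<le> norm (a e) * norm z) \<and> (a e = 0 \<longrightarrow> e = 0))"
  have "\<exists>e. \<forall>n::nat. P (e ` {..<n}) (e n)"
  \<comment> \<open>Course-of-values choice: the n-th vector maximises over the complement of the
    earlier ones, and \<open>P\<close> depends on \<open>e\<close> only through their set.\<close>
  proof (rule dependent_wf_choice [where R = less_than and P = "\<lambda>e n. P (e ` {..<n})"])
    show "P (e ` {..<n}) x = P (e' ` {..<n}) x" if "\<And>m. (m, n) \<in> less_than \<Longrightarrow> e m = e' m" for e e' n x
    proof -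
      have "e ` {..<n} = e' ` {..<n}" using that by (intro image_cong) auto
      then show ?thesis by simp
    qed
    show "\<exists>x. P (e ` {..<n}) x" for e n
      unfolding P_def by (rule compact_ops_attains_norm [OF assms])
  qed simp
  then obtain e where "\<And>n::nat. P (e ` {..<n}) (e n)" by blast
  then have e: "norm (e n) \<le> 1" "m < n \<Longrightarrow> cinner (e n) (e m) = 0"
    "(\<And>m. m < n \<Longrightarrow> cinner z (e m) = 0) \<Longrightarrow> norm (a z) \<le> norm (a (e n)) * norm z"
    "a (e n) = 0 \<Longrightarrow> e n = 0" for m n z
    unfolding P_def by auto
  define s where "s n = norm (a (e n))" for n
  \<comment> \<open>If \<open>s n = 0\<close>, the convention \<open>1 / 0 = 0\<close> makes
    \<open>f n = 0\<close>, as an \<open>ortho_sys\<close> permits.\<close>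
  define f where "f n = complex_of_real (1 / s n) *\<^sub>C a (e n)" for n
  \<comment> \<open>Maximality applied to \<open>e n\<close> itself gives
    \<open>s n \<le> s n * norm (e n)\<close>, hence \<open>norm (e n) \<ge> 1\<close>.\<close>
  have "norm (e n) = 1" if "s n \<noteq> 0" for n
    using e(3) [of n "e n"] e(1) [of n] e(2) [of _ n] that by (simp add: s_def)
  then have norm_e: "s n \<noteq> 0 \<Longrightarrow> norm (e n) = 1" "s n = 0 \<Longrightarrow> e n = 0" for n
    using e(4) [of n] by (auto simp: s_def)
  have oe: "cinner (e m) (e n) = 0" if "m \<noteq> n" for m n
    using that e(2) [of m n] e(2) [of n m] cinner_commute [of "e m" "e n"] by (cases "m < n") auto
  have oae': "cinner (a (e n)) (a (e m)) = 0" if "m < n" for m n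
    by (rule maximiser_orthogonal [OF lin, where A = "e ` {..<m}"])
      (use that e in \<open>auto intro!: oe\<close>)
  have oae: "cinner (a (e n)) (a (e m)) = 0" if "m \<noteq> n" for m n
    using that oae' [of m n] oae' [of n m] cinner_commute [of "a (e m)" "a (e n)"]
    by (cases "m < n") auto
  have ortho_e: "ortho_sys e" unfolding ortho_sys_def using oe norm_e by blast
  have ortho_f: "ortho_sys f"
    unfolding ortho_sys_def f_def
    by (auto simp: cinner_scaleC_left cinner_scaleC_right oae norm_scaleC s_def norm_divide)
  have dec: "decseq s"
  proof (rule decseq_SucI)
    fix n
    \<comment> \<open>The vector \<open>e (Suc n)\<close> is a competitor in the maximisation that
      produced \<open>e n\<close>.\<close>
    have "s (Suc n) \<le> s n * norm (e (Suc n))" unfolding s_def by (rule e(3)) (simp add: oe)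
    also have "\<dots> \<le> s n" using e(1) by (simp add: s_def mult_left_le)
    finally show "s (Suc n) \<le> s n" .
  qed
  obtain l where l: "s \<longlonglongrightarrow> l" "\<And>n. l \<le> s n"
    using decseq_convergent [OF dec, of 0] by (auto simp: s_def)
  \<comment> \<open>Otherwise the vectors \<open>a (e n)\<close> are pairwise orthogonal of norm at
    least \<open>l > 0\<close>, so no subsequence of them is Cauchy, contrary to
    compactness.\<close>
  have "l = 0"
  proof (rule ccontr)
    assume "l \<noteq> 0"
    moreover have "0 \<le> l" using l(1) by (intro LIMSEQ_le_const) (auto simp: s_def)
    ultimately have "0 < l" by simp
    obtain r y where r: "strict_mono r" and y: "(\<lambda>n. a (e (r n))) \<longlonglongrightarrow> y"
      using compact_ops_subseq [OF assms e(1)] .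
    obtain N where N: "\<And>m n. m \<ge> N \<Longrightarrow> n \<ge> N \<Longrightarrow> norm (a (e (r m)) - a (e (r n))) < l"
      using CauchyD [OF LIMSEQ_imp_Cauchy [OF y] \<open>0 < l\<close>] by blast
    have "inner (a (e (r N))) (a (e (r (Suc N)))) = 0"
      using oae [of "r (Suc N)" "r N"] r by (metis Re_cinner n_not_Suc_n strict_mono_eq zero_complex.simps(1))
    then have "(norm (a (e (r N)) - a (e (r (Suc N)))))\<^sup>2 = (s (r N))\<^sup>2 + (s (r (Suc N)))\<^sup>2"
      by (simp add: s_def power2_norm_eq_inner inner_diff inner_commute)
    moreover have "l\<^sup>2 \<le> (s (r N))\<^sup>2" using l(2) \<open>0 < l\<close> by (intro power_mono) auto
    moreover have "(norm (a (e (r N)) - a (e (r (Suc N)))))\<^sup>2 < l\<^sup>2"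
      by (intro power_strict_mono N) auto
    ultimately show False using zero_le_power2 [of "s (r (Suc N))"] by linarith
  qed
  have "(\<lambda>n. (complex_of_real (s n) * cinner x (e n)) *\<^sub>C f n) sums a x" for x
    unfolding sums_def
  proof (rule LIMSEQ_I, goal_cases)
    case (1 \<epsilon>)
    have "(\<lambda>n. s n * norm x) \<longlonglongrightarrow> 0 * norm x" using l(1) \<open>l = 0\<close> by (intro tendsto_intros) simp
    then have "\<forall>\<^sub>F n in sequentially. s n * norm x < \<epsilon>" using 1 by (simp add: order_tendstoD(2))
    then obtain M where M: "\<And>n. n \<ge> M \<Longrightarrow> s n * norm x < \<epsilon>" by (auto simp: eventually_sequentially)
    \<comment> \<open>The truncation error is \<open>a\<close> applied to a vector orthogonal to the
      first \<open>N\<close> maximisers, so maximality of \<open>e N\<close> bounds it by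
      \<open>s N\<close>.\<close>
    have "norm ((\<Sum>n<N. (complex_of_real (s n) * cinner x (e n)) *\<^sub>C f n) - a x) \<le> s N * norm x" for N
    proof -
      have "(complex_of_real (s n) * cinner x (e n)) *\<^sub>C f n = a (cinner x (e n) *\<^sub>C e n)" for n
        by (cases "s n = 0") (simp_all add: f_def L scaleC_scaleC norm_e(2))
      then have "a x - (\<Sum>n<N. (complex_of_real (s n) * cinner x (e n)) *\<^sub>C f n) = a (proj_rest e N x)"
        by (simp add: proj_rest_def L)
      then have "norm ((\<Sum>n<N. (complex_of_real (s n) * cinner x (e n)) *\<^sub>C f n) - a x) = norm (a (proj_rest e N x))"
        by (metis norm_minus_commute)
      also have "\<dots> \<le> s N * norm (proj_rest e N x)"
        unfolding s_def by (rule e(3)) (rule cinner_proj_rest [OF ortho_e])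
      also have "\<dots> \<le> s N * norm x"
        by (intro mult_left_mono norm_proj_rest_le [OF ortho_e]) (simp add: s_def)
      finally show ?thesis .
    qed
    then show ?case using M by (meson le_less_trans)
  qed
  moreover have "singular_sys s e f"
    unfolding singular_sys_def using dec l(1) \<open>l = 0\<close> ortho_e ortho_f norm_e
    by (simp add: f_def norm_scaleC norm_divide) (simp add: s_def)
  ultimately have "svd a s e f" by (simp add: svd_def)
  then show ?thesis by (rule that)
qed

section \<open>Identification of the eigenvalue sequence\<close>

text \<open>If \<open>l n > l' n\<close>, then \<open>l'\<close> takes the value \<open>l n\<close>
  only before \<open>n\<close>, where the sequences agree, while \<open>l\<close> takes it at
  \<open>n\<close> as well: the multiplicities differ.\<close>

lemma decseq_le_of_card_eq:
  fixes l l' :: "nat \<Rightarrow> real"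
  assumes dec: "decseq l'" and nonneg: "0 \<le> l' n"
    and fin: "\<And>t. t > 0 \<Longrightarrow> finite {n. l n = t}"
    and card: "\<And>t. t > 0 \<Longrightarrow> card {n. l n = t} = card {n. l' n = t}"
    and eq: "\<And>m. m < n \<Longrightarrow> l m = l' m"
  shows "l n \<le> l' n"
proof (rule ccontr)
  assume less: "\<not> l n \<le> l' n"
  then have pos: "l n > 0" using nonneg by linarith
  have less': "l' m < l n" if "m \<ge> n" for m using dec that less by (fastforce simp: decseq_def)
  have "m < n" if "l' m = l n" for m using less' [of m] that by (cases "n \<le> m") auto
  then have "{m. l' m = l n} \<subset> {m. l m = l n}" using eq by force
  then have "card {m. l' m = l n} < card {m. l m = l n}" by (rule psubset_card_mono [OF fin [OF pos]])
  then show False using card [OF pos] by simp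
qed

text \<open>This uniqueness makes the definite description in \<open>eigval\<close> meaningful:
  positive multiplicities fix the sequence index by index, and what remains is 0.\<close>

lemma decseq_eq_of_card_eq:
  fixes l l' :: "nat \<Rightarrow> real"
  assumes "decseq l" "\<And>n. 0 \<le> l n" "decseq l'" "\<And>n. 0 \<le> l' n"
    and "\<And>t. t > 0 \<Longrightarrow> finite {n. l n = t}" "\<And>t. t > 0 \<Longrightarrow> finite {n. l' n = t}"
    and "\<And>t. t > 0 \<Longrightarrow> card {n. l n = t} = card {n. l' n = t}"
  shows "l = l'"
proof
  fix n show "l n = l' n"
  proof (induction n rule: less_induct)
    case (less n)
    show ?case
      using decseq_le_of_card_eq [of l' n l] decseq_le_of_card_eq [of l n l'] assms less by force
  qed
qed

text \<open>The vectors \<open>e n\<close> with \<open>s n = t\<close> form a basis of the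
  eigenspace. There are finitely many because \<open>s\<close> tends to 0.\<close>

lemma svd_eigenspace_dim:
  assumes p: "svd p s e e" and "t > 0"
  shows "finite {n. s n = t} \<and> card {n. s n = t} = cspace.dim (eigenspace p (complex_of_real t))"
proof -
  define I where "I = {n. s n = t}"
  note D = singular_sysD [OF svdD(1) [OF p]]
  have "\<forall>\<^sub>F n in sequentially. s n < t" using D(2) \<open>t > 0\<close> by (rule order_tendstoD(2))
  then obtain N where "\<And>n. n \<ge> N \<Longrightarrow> s n < t" by (auto simp: eventually_sequentially)
  then have "I \<subseteq> {..<N}" by (force simp: I_def not_less [symmetric])
  then have fin: "finite I" by (rule finite_subset) simp
  have one: "cinner (e n) (e n) = 1" if "n \<in> I" for n
    using that \<open>t > 0\<close> D(5) [of n] ortho_sysD(4) [OF D(3), of n] by (auto simp: I_def)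
  have inj: "inj_on e I"
    using one ortho_sysD(1) [OF D(3)] by (intro inj_onI) (metis zero_neq_one)
  have indep: "\<not> cspace.dependent (e ` I)"
  proof
    assume "cspace.dependent (e ` I)"
    then obtain u v where v: "v \<in> e ` I" "u v \<noteq> 0" and 0: "(\<Sum>v\<in>e ` I. u v *\<^sub>C v) = 0"
      using cspace.dependent_finite [of "e ` I"] fin by auto
    then obtain m where m: "m \<in> I" "v = e m" by auto
    have "(\<Sum>n\<in>I. u (e n) *\<^sub>C e n) = 0" using 0 by (simp add: sum.reindex [OF inj])
    then have "u (e m) = 0" using cinner_sum_ortho [OF D(3) fin m(1), of "\<lambda>n. u (e n)"] one [OF m(1)] by simp
    then show False using v m by simp
  qed
  have "eigenspace p (complex_of_real t) \<subseteq> cspace.span (e ` I)"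
  proof
    fix x assume "x \<in> eigenspace p (complex_of_real t)"
    then have px: "p x = complex_of_real t *\<^sub>C x" by (simp add: eigenspace_def)
    \<comment> \<open>Eigenvectors of a self-adjoint operator for distinct eigenvalues are
      orthogonal.\<close>
    have "cinner x (e n) = 0" if "n \<notin> I" for n
    proof -
      have "complex_of_real t * cinner x (e n) = complex_of_real (s n) * cinner x (e n)"
        using svd_adjoint [OF p p, of x "e n"]
        by (simp add: px svd_apply [OF p] cinner_scaleC_left cinner_scaleC_right)
      then show ?thesis using that by (auto simp: I_def)
    qed
    then have "(\<lambda>n. (complex_of_real (s n) * cinner x (e n)) *\<^sub>C e n) sums
        (\<Sum>n\<in>I. (complex_of_real (s n) * cinner x (e n)) *\<^sub>C e n)"
      by (intro sums_finite fin) simp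
    then have psum: "p x = (\<Sum>n\<in>I. (complex_of_real (s n) * cinner x (e n)) *\<^sub>C e n)"
      using svdD(2) [OF p, of x] sums_unique2 by blast
    have "complex_of_real t *\<^sub>C x \<in> cspace.span (e ` I)"
      unfolding px [symmetric] psum
      by (intro cspace.span_sum cspace.span_scale cspace.span_base imageI)
    then have "complex_of_real (1 / t) *\<^sub>C complex_of_real t *\<^sub>C x \<in> cspace.span (e ` I)"
      by (rule cspace.span_scale)
    then show "x \<in> cspace.span (e ` I)" using \<open>t > 0\<close> by (simp add: scaleC_scaleC scaleC_one)
  qed
  moreover have "e ` I \<subseteq> eigenspace p (complex_of_real t)"
    using svd_apply [OF p] by (auto simp: eigenspace_def I_def)
  ultimately have "cspace.dim (eigenspace p (complex_of_real t)) = card (e ` I)"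
    using cspace.dim_unique [OF _ _ indep] by blast
  then show ?thesis using fin card_image [OF inj] by (simp add: I_def)
qed

lemma svd_eigval:
  assumes p: "svd p s e e"
  shows "eigval p = s"
proof -
  note D = singular_sysD [OF svdD(1) [OF p]]
  show ?thesis
    unfolding eigval_def
  proof (rule the_equality)
    show "decseq s \<and> (\<forall>n. 0 \<le> s n) \<and> (\<forall>t>0. finite {n. s n = t} \<and>
        card {n. s n = t} = cspace.dim (eigenspace p (complex_of_real t)))"
      using D(1,7) svd_eigenspace_dim [OF p] by blast
    then show "l = s" if "decseq l \<and> (\<forall>n. 0 \<le> l n) \<and> (\<forall>t>0. finite {n. l n = t} \<and>
        card {n. l n = t} = cspace.dim (eigenspace p (complex_of_real t)))" for l
      using that by (intro decseq_eq_of_card_eq) auto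
  qed
qed

lemma svd_choquet_norm:
  assumes "svd a s e f"
  shows "choquet_norm \<alpha> a = (\<Sum>n. ennreal ((s n - s (Suc n)) * \<alpha> (Suc n)))"
  unfolding choquet_norm_def choquet_trace_def svd_eigval [OF svd_op_abs [OF assms]] ..

section \<open>Ky Fan's principle\<close>

text \<open>A total weight of at most \<open>k\<close>, with at most 1 per index, is best spent on
  the \<open>k\<close> largest terms. After subtracting the level \<open>s k\<close>, the factors
  are nonnegative before \<open>k\<close> and nonpositive from \<open>k\<close> on.\<close>

lemma decseq_weighted_sum_le:
  fixes s v :: "nat \<Rightarrow> real"
  assumes dec: "decseq s" and nonneg: "\<And>n. 0 \<le> s n"
    and v: "\<And>n. 0 \<le> v n" "\<And>n. v n \<le> 1" and total: "(\<Sum>n<N. v n) \<le> real k"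
  shows "(\<Sum>n<N. s n * v n) \<le> (\<Sum>n<k. s n)"
proof -
  have "(\<Sum>n<N. s n * v n) = (\<Sum>n<N. (s n - s k) * v n) + s k * (\<Sum>n<N. v n)"
    by (simp add: sum_distrib_left left_diff_distrib sum_subtractf)
  also have "(\<Sum>n<N. (s n - s k) * v n) \<le> (\<Sum>n<N. if n < k then s n - s k else 0)"
  proof (rule sum_mono)
    fix n
    show "(s n - s k) * v n \<le> (if n < k then s n - s k else 0)"
    proof (cases "n < k")
      case True
      then have "s k \<le> s n" using dec by (simp add: decseq_def)
      then show ?thesis using True v(2) by (simp add: mult_left_le)
    next
      case False
      then have "s n \<le> s k" using dec by (simp add: decseq_def)
      then show ?thesis using False v(1) by (simp add: mult_nonpos_nonneg)
    qed
  qed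
  also have "\<dots> = (\<Sum>n | n < N \<and> n < k. s n - s k)"
    by (simp add: sum.If_cases Int_def)
  also have "\<dots> \<le> (\<Sum>n<k. s n - s k)"
    using dec by (intro sum_mono2) (auto simp: decseq_def)
  also have "s k * (\<Sum>n<N. v n) \<le> s k * real k"
    using total nonneg by (rule mult_left_mono)
  finally show ?thesis by (simp add: sum_subtractf mult.commute)
qed

text \<open>Expanding \<open>a\<close> turns the left side into a sum of \<open>s n\<close> against
  coefficients which the inequality of arithmetic and geometric means bounds by weights
  \<open>v n\<close>. Bessel for \<open>x\<close> and \<open>y\<close> gives
  \<open>v n \<le> 1\<close>; Bessel for \<open>e\<close> and \<open>f\<close> bounds the total
  weight by \<open>k\<close>.\<close>

lemma ky_fan_le:
  assumes a: "svd a s e f" and x: "ortho_sys x" and y: "ortho_sys y"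
  shows "(\<Sum>j<k. Re (cinner (a (x j)) (y j))) \<le> (\<Sum>n<k. s n)"
proof -
  note D = singular_sysD [OF svdD(1) [OF a]]
  let ?X = "\<lambda>j n. cmod (cinner (x j) (e n))" and ?Y = "\<lambda>j n. cmod (cinner (y j) (f n))"
  define v where "v n = (\<Sum>j<k. ((?X j n)\<^sup>2 + (?Y j n)\<^sup>2) / 2)" for n
  have sq: "(norm (z n))\<^sup>2 \<le> 1" if "ortho_sys z" for z :: "nat \<Rightarrow> 'a" and n
    using ortho_sysD(3) [OF that] by (simp add: power_le_one)
  \<comment> \<open>Bessel's inequality for the system \<open>z\<close>, with the conjugate
    coefficients.\<close>
  have swap: "(\<Sum>j<k. (cmod (cinner (z j) w))\<^sup>2) \<le> (norm w)\<^sup>2" if "ortho_sys z" for z and w :: 'a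
    using bessel [OF that, of "{..<k}" w] cinner_commute [of "z _" w] by simp
  have v1: "v n \<le> 1" for n
    using swap [OF x, of "e n"] swap [OF y, of "f n"] sq [OF D(3), of n] sq [OF D(4), of n]
    by (simp add: v_def sum.distrib flip: sum_divide_distrib)
  have "(\<Sum>n<N. v n) = (\<Sum>j<k. ((\<Sum>n<N. (?X j n)\<^sup>2) + (\<Sum>n<N. (?Y j n)\<^sup>2)) / 2)" for N
    unfolding v_def by (subst sum.swap) (simp add: sum.distrib flip: sum_divide_distrib)
  moreover have "\<dots> N \<le> (\<Sum>j<k. 1)" for N
  proof (rule sum_mono)
    fix j
    show "((\<Sum>n<N. (?X j n)\<^sup>2) + (\<Sum>n<N. (?Y j n)\<^sup>2)) / 2 \<le> 1"
      using bessel [OF D(3), of "{..<N}" "x j"] bessel [OF D(4), of "{..<N}" "y j"] sq [OF x, of j] sq [OF y, of j]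
      by simp
  qed
  ultimately have vk: "(\<Sum>n<N. v n) \<le> real k" for N by simp
  have partial: "(\<Sum>j<k. \<Sum>n<N. s n * Re (cinner (x j) (e n) * cinner (f n) (y j))) \<le> (\<Sum>n<k. s n)" for N
  proof -
    have "Re (cinner (x j) (e n) * cinner (f n) (y j)) \<le> ((?X j n)\<^sup>2 + (?Y j n)\<^sup>2) / 2" for j n
    proof -
      have "Re (cinner (x j) (e n) * cinner (f n) (y j)) \<le> ?X j n * ?Y j n"
        using complex_Re_le_cmod [of "cinner (x j) (e n) * cinner (f n) (y j)"] cinner_commute [of "f n" "y j"]
        by (simp add: norm_mult)
      also have "\<dots> \<le> ((?X j n)\<^sup>2 + (?Y j n)\<^sup>2) / 2"
        using sum_squares_bound [of "?X j n" "?Y j n"] by simp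
      finally show ?thesis .
    qed
    then have "(\<Sum>j<k. \<Sum>n<N. s n * Re (cinner (x j) (e n) * cinner (f n) (y j)))
        \<le> (\<Sum>j<k. \<Sum>n<N. s n * (((?X j n)\<^sup>2 + (?Y j n)\<^sup>2) / 2))"
      by (intro sum_mono mult_left_mono D(7))
    also have "\<dots> = (\<Sum>n<N. s n * v n)"
      unfolding v_def sum_distrib_left by (rule sum.swap)
    also have "\<dots> \<le> (\<Sum>n<k. s n)"
      by (rule decseq_weighted_sum_le [OF D(1,7) _ v1 vk]) (simp add: v_def sum_nonneg)
    finally show ?thesis .
  qed
  have "Re (complex_of_real r * z) = r * Re z" for r z by simp
  then have "(\<lambda>n. s n * Re (cinner (x j) (e n) * cinner (f n) (y j))) sums Re (cinner (a (x j)) (y j))" for j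
    using sums_Re [OF sums_cinner_left [OF svdD(2) [OF a, of "x j"], of "y j"]]
    by (simp only: cinner_scaleC_left mult.assoc)
  then have "(\<lambda>N. \<Sum>j<k. \<Sum>n<N. s n * Re (cinner (x j) (e n) * cinner (f n) (y j)))
      \<longlonglongrightarrow> (\<Sum>j<k. Re (cinner (a (x j)) (y j)))"
    unfolding sums_def by (intro tendsto_sum)
  then show ?thesis by (rule LIMSEQ_le_const2) (use partial in blast)
qed

lemma ky_fan_eq:
  assumes "svd a s e f"
  shows "Re (cinner (a (e n)) (f n)) = s n"
  using singular_sysD(6) [OF svdD(1) [OF assms], of n]
  by (cases "s n = 0") (simp_all add: svd_apply [OF assms] cinner_scaleC_left cinner_self)

text \<open>The singular vectors \<open>p\<close>, \<open>q\<close> of the sum attain its Ky Fan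
  value and are competitors for \<open>a\<close> and for \<open>b\<close>.\<close>

lemma ky_fan_add:
  assumes a: "svd a s e f" and b: "svd b t g h" and ab: "svd (\<lambda>x. a x + b x) u p q"
  shows "(\<Sum>n<k. u n) \<le> (\<Sum>n<k. s n) + (\<Sum>n<k. t n)"
proof -
  note D = singular_sysD [OF svdD(1) [OF ab]]
  have "(\<Sum>n<k. u n) = (\<Sum>n<k. Re (cinner (a (p n)) (q n))) + (\<Sum>n<k. Re (cinner (b (p n)) (q n)))"
    by (simp add: ky_fan_eq [OF ab, symmetric] cinner_add_left sum.distrib)
  then show ?thesis using ky_fan_le [OF a D(3,4), of k] ky_fan_le [OF b D(3,4), of k] by linarith
qed

section \<open>Summation by parts and the triangle inequality\<close>

text \<open>Single terms of \<open>w\<close> may be negative; only their partial sums have a sign.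
  In the induction step, lowering the factor from \<open>d N\<close> to \<open>d (Suc N)\<close>
  decreases the left side because it multiplies such a partial sum.\<close>

lemma sum_weighted_partial_sums:
  fixes w d :: "nat \<Rightarrow> real"
  assumes "decseq d" "\<And>k. 0 \<le> (\<Sum>n<k. w n)"
  shows "d N * (\<Sum>n<N. w n) \<le> (\<Sum>n<N. d n * w n)"
proof (induction N)
  case (Suc N)
  have "d (Suc N) * (\<Sum>n<Suc N. w n) \<le> d N * (\<Sum>n<Suc N. w n)"
    by (intro mult_right_mono assms(2)) (use assms(1) in \<open>simp add: decseq_Suc_iff\<close>)
  then show ?case using Suc by (simp add: distrib_left)
qed simp

text \<open>Like the eigenvalues, the increments are indexed from 0: \<open>d n\<close> is
  \<open>c (n + 1)\<close> in the notation of the theorem.\<close>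

context
  fixes \<alpha> :: "nat \<Rightarrow> real" and d :: "nat \<Rightarrow> real"
  assumes nonneg: "\<And>i. 0 \<le> \<alpha> i" and mono: "mono \<alpha>" and zero: "\<alpha> 0 = 0"
  defines "d \<equiv> \<lambda>n. \<alpha> (Suc n) - \<alpha> n"
begin

lemma increment_nonneg: "0 \<le> d n"
  using mono by (simp add: d_def mono_iff_le_Suc)

lemma sum_increment: "(\<Sum>n<N. d n) = \<alpha> N"
  unfolding d_def using sum_lessThan_telescope [of \<alpha> N] zero by simp

text \<open>Summation by parts. The boundary term is nonnegative for nonnegative \<open>s\<close>,
  so the upper estimate \<open>choquet_sum_le\<close> can drop it at once; the lower estimate has to
  remove it differently.\<close>

lemma choquet_partial_sum:
  "(\<Sum>n<N. (s n - s (Suc n)) * \<alpha> (Suc n)) = (\<Sum>n<N. d n * s n) - s N * \<alpha> N"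
  by (induction N) (simp_all add: zero d_def algebra_simps)

lemma choquet_sum_le:
  assumes "decseq s" "\<And>n. 0 \<le> s n" "\<And>N. ennreal (\<Sum>n<N. d n * s n) \<le> B"
  shows "(\<Sum>n. ennreal ((s n - s (Suc n)) * \<alpha> (Suc n))) \<le> B"
proof (rule suminf_le_const)
  fix N
  have "(\<Sum>n<N. ennreal ((s n - s (Suc n)) * \<alpha> (Suc n))) = ennreal (\<Sum>n<N. (s n - s (Suc n)) * \<alpha> (Suc n))"
    using assms(1) nonneg by (intro sum_ennreal) (simp add: decseq_Suc_iff)
  also have "\<dots> \<le> ennreal (\<Sum>n<N. d n * s n)"
    unfolding choquet_partial_sum using assms(2) nonneg by (intro ennreal_leI) simp
  finally show "(\<Sum>n<N. ennreal ((s n - s (Suc n)) * \<alpha> (Suc n))) \<le> B" using assms(3) order_trans by blast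
qed simp

text \<open>Replacing \<open>s n\<close> by \<open>s n - s M\<close> absorbs the boundary term:
  summed over \<open>n < M\<close> it is exactly a partial Choquet sum. Letting \<open>M\<close>
  tend to infinity with \<open>N\<close> fixed restores \<open>s n\<close>.\<close>

lemma choquet_sum_ge:
  assumes dec: "decseq s" and "s \<longlonglongrightarrow> 0"
  shows "ennreal (\<Sum>n<N. d n * s n) \<le> (\<Sum>n. ennreal ((s n - s (Suc n)) * \<alpha> (Suc n)))"
proof (rule LIMSEQ_le_const2)
  have "(\<lambda>M. \<Sum>n<N. d n * (s n - s M)) \<longlonglongrightarrow> (\<Sum>n<N. d n * (s n - 0))"
    using assms(2) by (intro tendsto_intros)
  then show "(\<lambda>M. ennreal (\<Sum>n<N. d n * (s n - s M))) \<longlonglongrightarrow> ennreal (\<Sum>n<N. d n * s n)"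
    by (intro tendsto_ennrealI) simp
  have "ennreal (\<Sum>n<N. d n * (s n - s M)) \<le> (\<Sum>n. ennreal ((s n - s (Suc n)) * \<alpha> (Suc n)))" if "M \<ge> N" for M
  proof -
    have "(\<Sum>n<N. d n * (s n - s M)) \<le> (\<Sum>n<M. d n * (s n - s M))"
      using that dec increment_nonneg by (intro sum_mono2) (auto simp: decseq_def)
    also have "\<dots> = (\<Sum>n<M. (s n - s (Suc n)) * \<alpha> (Suc n))"
      unfolding choquet_partial_sum
      by (simp add: right_diff_distrib sum_subtractf sum_increment mult.commute flip: sum_distrib_left sum_distrib_right)
    finally have "ennreal (\<Sum>n<N. d n * (s n - s M)) \<le> ennreal (\<Sum>n<M. (s n - s (Suc n)) * \<alpha> (Suc n))"
      by (rule ennreal_leI)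
    also have "\<dots> = (\<Sum>n<M. ennreal ((s n - s (Suc n)) * \<alpha> (Suc n)))"
      using dec nonneg by (intro sum_ennreal [symmetric]) (simp add: decseq_Suc_iff)
    also have "\<dots> \<le> (\<Sum>n. ennreal ((s n - s (Suc n)) * \<alpha> (Suc n)))"
      by (rule sum_le_suminf) auto
    finally show ?thesis .
  qed
  then show "\<exists>K. \<forall>M\<ge>K. ennreal (\<Sum>n<N. d n * (s n - s M)) \<le> (\<Sum>n. ennreal ((s n - s (Suc n)) * \<alpha> (Suc n)))"
    by blast
qed

lemma choquet_sum_finite:
  assumes "decseq s" "s \<longlonglongrightarrow> 0" "\<And>n. n \<ge> N \<Longrightarrow> s n = 0"
  shows "(\<Sum>n. ennreal ((s n - s (Suc n)) * \<alpha> (Suc n))) = ennreal (\<Sum>n<N. d n * s n)"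
proof (rule antisym)
  have s: "0 \<le> s n" for n using decseq_ge [OF assms(1,2)] .
  have "(\<Sum>n<M. d n * s n) \<le> (\<Sum>n<N. d n * s n)" for M
  proof -
    have "(\<Sum>n<M. d n * s n) \<le> (\<Sum>n<max M N. d n * s n)"
      using s increment_nonneg by (intro sum_mono2) auto
    also have "\<dots> = (\<Sum>n<N. d n * s n)" using assms(3) by (intro sum.mono_neutral_right) auto
    finally show ?thesis .
  qed
  then show "(\<Sum>n. ennreal ((s n - s (Suc n)) * \<alpha> (Suc n))) \<le> ennreal (\<Sum>n<N. d n * s n)"
    by (intro choquet_sum_le assms s ennreal_leI)
qed (rule choquet_sum_ge [OF assms(1,2)])

lemma choquet_norm_triangle:
  assumes "decseq d" and a: "a \<in> compact_ops" and b: "b \<in> compact_ops"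
  shows "choquet_norm \<alpha> (\<lambda>x. a x + b x) \<le> choquet_norm \<alpha> a + choquet_norm \<alpha> b"
proof -
  obtain s e f where s: "svd a s e f" using compact_ops_svd [OF a] .
  obtain t g h where t: "svd b t g h" using compact_ops_svd [OF b] .
  obtain u p q where u: "svd (\<lambda>x. a x + b x) u p q" using compact_ops_svd [OF compact_ops_add [OF a b]] .
  note S = singular_sysD [OF svdD(1) [OF s]] and T = singular_sysD [OF svdD(1) [OF t]]
    and U = singular_sysD [OF svdD(1) [OF u]]
  show ?thesis
    unfolding svd_choquet_norm [OF u]
  proof (rule choquet_sum_le [OF U(1,7)])
    fix N
    \<comment> \<open>Ky Fan gives the sign of the partial sums of \<open>s n + t n - u n\<close>;
      the decreasing weights \<open>d\<close> then preserve it.\<close>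
    have w: "0 \<le> (\<Sum>n<k. s n + t n - u n)" for k
      using ky_fan_add [OF s t u, of k] by (simp add: sum.distrib sum_subtractf)
    have "0 \<le> d N * (\<Sum>n<N. s n + t n - u n)" by (intro mult_nonneg_nonneg w increment_nonneg)
    also have "\<dots> \<le> (\<Sum>n<N. d n * (s n + t n - u n))"
      by (rule sum_weighted_partial_sums [OF assms(1) w])
    finally have "(\<Sum>n<N. d n * u n) \<le> (\<Sum>n<N. d n * s n) + (\<Sum>n<N. d n * t n)"
      by (simp add: algebra_simps sum.distrib sum_subtractf)
    then have "ennreal (\<Sum>n<N. d n * u n) \<le> ennreal (\<Sum>n<N. d n * s n) + ennreal (\<Sum>n<N. d n * t n)"
      using S(7) T(7) increment_nonneg by (simp add: ennreal_leI sum_nonneg flip: ennreal_plus)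
    also have "\<dots> \<le> choquet_norm \<alpha> a + choquet_norm \<alpha> b"
      unfolding svd_choquet_norm [OF s] svd_choquet_norm [OF t]
      by (intro add_mono choquet_sum_ge S T)
    finally show "ennreal (\<Sum>n<N. d n * u n) \<le> choquet_norm \<alpha> a + choquet_norm \<alpha> b" .
  qed
qed

end

section \<open>Operators of finite rank and the converse\<close>

text \<open>A Gram-Schmidt step: infinite dimension provides a vector outside the span of the first
  \<open>N\<close>, and its normalised remainder fills the slot \<open>N\<close>.\<close>

lemma ortho_sys_exists:
  assumes "\<not> (\<exists>B :: 'h::complex_hilbert set. finite B \<and> cspace.span B = UNIV)"
  shows "\<exists>e :: nat \<Rightarrow> 'h. ortho_sys e \<and> (\<forall>n<N. norm (e n) = 1) \<and> (\<forall>n\<ge>N. e n = 0)"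
proof (induction N)
  case 0
  show ?case by (rule exI [of _ "\<lambda>_. 0"]) (simp add: ortho_sys_def)
next
  case (Suc N)
  then obtain e :: "nat \<Rightarrow> 'h" where e: "ortho_sys e" "\<And>n. n < N \<Longrightarrow> norm (e n) = 1" "\<And>n. n \<ge> N \<Longrightarrow> e n = 0"
    by blast
  have "cspace.span (e ` {..<N}) \<noteq> UNIV" using assms by blast
  then obtain x where x: "x \<notin> cspace.span (e ` {..<N})" by blast
  define z where "z = proj_rest e N x"
  have "(\<Sum>n<N. cinner x (e n) *\<^sub>C e n) \<in> cspace.span (e ` {..<N})"
    by (intro cspace.span_sum cspace.span_scale cspace.span_base) auto
  then have "z \<noteq> 0" using x by (auto simp: z_def proj_rest_def)
  define e' where "e' = e(N := complex_of_real (1 / norm z) *\<^sub>C z)"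
  have "cinner z (e n) = 0" for n
    using cinner_proj_rest [OF e(1), of n N x] e(3) [of n] by (cases "n < N") (auto simp: z_def)
  moreover from this have "cinner (e n) z = 0" for n using cinner_commute [of "e n" z] by simp
  ultimately have "ortho_sys e'"
    using e(1) \<open>z \<noteq> 0\<close>
    by (auto simp: ortho_sys_def e'_def cinner_scaleC_left cinner_scaleC_right norm_scaleC norm_divide)
  moreover have "norm (e' n) = 1" if "n < Suc N" for n
    using that e(2) \<open>z \<noteq> 0\<close> by (auto simp: e'_def norm_scaleC norm_divide less_Suc_eq)
  moreover have "e' n = 0" if "n \<ge> Suc N" for n using that e(3) by (auto simp: e'_def)
  ultimately show ?case by blast
qed

lemma svd_finite_rank:
  assumes "svd a s e f" "\<And>n. n \<ge> N \<Longrightarrow> s n = 0"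
  shows "a x = (\<Sum>n<N. (complex_of_real (s n) * cinner x (e n)) *\<^sub>C f n)"
proof -
  have "(\<lambda>n. (complex_of_real (s n) * cinner x (e n)) *\<^sub>C f n) sums
      (\<Sum>n<N. (complex_of_real (s n) * cinner x (e n)) *\<^sub>C f n)"
    by (intro sums_finite) (auto simp: assms(2))
  then show ?thesis using svdD(2) [OF assms(1), of x] sums_unique2 by blast
qed

text \<open>One compact set serves all bounded coefficients: each step adds the continuous image of
  a closed disc.\<close>

lemma compact_finite_combinations:
  fixes f :: "nat \<Rightarrow> 'h::complex_hilbert"
  shows "\<exists>K. compact K \<and> (\<forall>z. (\<forall>n<N. cmod (z n) \<le> B) \<longrightarrow> (\<Sum>n<N. z n *\<^sub>C f n) \<in> K)"
proof (induction N)
  case 0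
  show ?case by (rule exI [of _ "{0}"]) simp
next
  case (Suc N)
  then obtain K where K: "compact K"
    "\<And>z. (\<forall>n<N. cmod (z n) \<le> B) \<Longrightarrow> (\<Sum>n<N. z n *\<^sub>C f n) \<in> K" by blast
  let ?L = "(\<lambda>c. c *\<^sub>C f N) ` cball 0 B"
  have "continuous_on (cball 0 B) (\<lambda>c. c *\<^sub>C f N)"
    by (intro bounded_bilinear.continuous_on [OF bounded_bilinear_scaleC] continuous_intros)
  then have L: "compact ?L" by (rule compact_continuous_image) simp
  show ?case
  proof (intro exI conjI allI impI)
    show "compact {x + y | x y. x \<in> K \<and> y \<in> ?L}" by (rule compact_sums [OF K(1) L])
    show "(\<Sum>n<Suc N. z n *\<^sub>C f n) \<in> {x + y | x y. x \<in> K \<and> y \<in> ?L}" if "\<forall>n<Suc N. cmod (z n) \<le> B" for z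
      using K(2) [of z] that by (auto intro!: exI)
  qed
qed

text \<open>On the unit ball all coefficients are bounded by \<open>s 0\<close>, so the image lies
  in one compact set of finite combinations.\<close>

lemma svd_finite_rank_compact:
  assumes a: "svd a s e f" and 0: "\<And>n. n \<ge> N \<Longrightarrow> s n = 0"
  shows "a \<in> compact_ops"
proof -
  note D = singular_sysD [OF svdD(1) [OF a]]
  obtain K where K: "compact K" "\<And>z. (\<forall>n<N. cmod (z n) \<le> s 0) \<Longrightarrow> (\<Sum>n<N. z n *\<^sub>C f n) \<in> K"
    using compact_finite_combinations by metis
  have "a x \<in> K" if "norm x \<le> 1" for x
  proof -
    have "cmod (complex_of_real (s n) * cinner x (e n)) \<le> s 0" for n
    proof -
      have "(cmod (cinner x (e n)))\<^sup>2 \<le> (norm x)\<^sup>2" using bessel [OF D(3), of "{n}" x] by simp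
      then have "cmod (cinner x (e n)) \<le> 1" using that by (meson norm_ge_zero order_trans power2_le_imp_le)
      moreover have "s n \<le> s 0" using D(1) by (simp add: decseq_def)
      ultimately show ?thesis
        using D(7) [of n] mult_mono [of "s n" "s 0" "cmod (cinner x (e n))" 1] by (simp add: norm_mult)
    qed
    then have "(\<Sum>n<N. (complex_of_real (s n) * cinner x (e n)) *\<^sub>C f n) \<in> K" by (intro K(2)) simp
    then show ?thesis using svd_finite_rank [where x = x, OF a 0] by simp
  qed
  then have "a ` cball 0 1 \<subseteq> K" by auto
  then show ?thesis
    using compact_closure_subset [OF K(1)] svd_clinear [OF a] by (simp add: compact_ops_def)
qed

lemma singular_sys_finite:
  assumes "ortho_sys e" "ortho_sys f" "decseq s" "\<And>n. n \<ge> N \<Longrightarrow> s n = 0"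
    "\<And>n. n < N \<Longrightarrow> norm (e n) = 1" "\<And>n. n < N \<Longrightarrow> norm (f n) = 1"
  shows "singular_sys s e f"
proof -
  have "s \<longlonglongrightarrow> 0"
    by (rule tendsto_eventually) (use assms(4) in \<open>auto simp: eventually_sequentially\<close>)
  moreover have "n < N" if "s n \<noteq> 0" for n using that assms(4) [of n] by (cases "n < N") auto
  ultimately show ?thesis using assms by (auto simp: singular_sys_def)
qed

text \<open>The projections onto the spans of \<open>e 0, \<dots>, e k\<close> and of \<open>e 0, \<dots>, e (k - 1), e (k + 1)\<close> have
  trace \<open>\<alpha> (k + 1)\<close>, and their sum has eigenvalues 2 (\<open>k\<close> times), 1, 1.\<close>

lemma choquet_norm_triangle_imp_concave:
  fixes \<alpha> :: "nat \<Rightarrow> real"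
  assumes inf: "\<not> (\<exists>B :: 'h::complex_hilbert set. finite B \<and> cspace.span B = UNIV)"
    and nonneg: "\<And>i. 0 \<le> \<alpha> i" and mono: "mono \<alpha>" and zero: "\<alpha> 0 = 0"
    and triangle: "\<And>a b. a \<in> compact_ops \<Longrightarrow> b \<in> (compact_ops :: ('h \<Rightarrow> 'h) set) \<Longrightarrow>
      choquet_norm \<alpha> (\<lambda>x. a x + b x) \<le> choquet_norm \<alpha> a + choquet_norm \<alpha> b"
  shows "\<alpha> (Suc (Suc k)) + \<alpha> k \<le> 2 * \<alpha> (Suc k)"
proof -
  obtain e :: "nat \<Rightarrow> 'h" where e: "ortho_sys e" "\<And>n. n < Suc (Suc k) \<Longrightarrow> norm (e n) = 1"
    using ortho_sys_exists [OF inf, of "Suc (Suc k)"] by blast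
  \<comment> \<open>Swapping the indices \<open>k\<close> and \<open>Suc k\<close> makes the first
    \<open>k + 1\<close> vectors of \<open>e'\<close> equal to \<open>e 0\<close>, ...,
    \<open>e (k - 1)\<close>, \<open>e (k + 1)\<close>.\<close>
  define e' where "e' = e \<circ> Transposition.transpose k (Suc k)"
  have e': "ortho_sys e'"
    using e(1) by (auto simp: e'_def ortho_sys_def inj_eq [OF inj_transpose])
  have norm_e': "norm (e' n) = 1" if "n < Suc k" for n
    unfolding e'_def comp_apply by (rule e(2)) (use that in \<open>auto simp: Transposition.transpose_def\<close>)
  define s :: "nat \<Rightarrow> real" where "s n = (if n < Suc k then 1 else 0)" for n
  define u :: "nat \<Rightarrow> real" where "u n = (if n < k then 2 else if n < Suc (Suc k) then 1 else 0)" for n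
  have dec: "decseq s" "decseq u" by (auto simp: s_def u_def decseq_Suc_iff)
  have s0: "s n = 0" if "n \<ge> Suc k" for n using that by (simp add: s_def)
  have u0: "u n = 0" if "n \<ge> Suc (Suc k)" for n using that by (simp add: u_def)
  obtain a where a: "svd a s e e"
    using singular_sys_imp_svd [OF singular_sys_finite [OF e(1) e(1) dec(1) s0]] e(2) less_SucI by metis
  obtain b where b: "svd b s e' e'"
    using singular_sys_imp_svd [OF singular_sys_finite [OF e' e' dec(1) s0]] norm_e' by metis
  obtain c where c: "svd c u e e"
    using singular_sys_imp_svd [OF singular_sys_finite [OF e(1) e(1) dec(2) u0]] e(2) by metis
  have "c x = a x + b x" for x
  proof -
    let ?g = "\<lambda>n. cinner x (e n) *\<^sub>C e n"
    have "a x = (\<Sum>n<k. ?g n) + ?g k"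
      using svd_finite_rank [where x = x, OF a s0] by (simp add: s_def)
    moreover have "b x = (\<Sum>n<k. ?g n) + ?g (Suc k)"
      using svd_finite_rank [where x = x, OF b s0] by (simp add: s_def e'_def Transposition.transpose_def)
    moreover have "c x = (\<Sum>n<k. ?g n + ?g n) + ?g k + ?g (Suc k)"
      using svd_finite_rank [where x = x, OF c u0] by (simp add: u_def cspace.scale_left_distrib [symmetric])
    ultimately show ?thesis by (simp add: sum.distrib)
  qed
  then have "c = (\<lambda>x. a x + b x)" by blast
  then have "choquet_norm \<alpha> c \<le> choquet_norm \<alpha> a + choquet_norm \<alpha> b"
    using triangle [OF svd_finite_rank_compact [OF a s0] svd_finite_rank_compact [OF b s0]] by simp
  moreover have "choquet_norm \<alpha> a = ennreal (\<alpha> (Suc k))" "choquet_norm \<alpha> b = ennreal (\<alpha> (Suc k))"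
  proof -
    have "(\<Sum>n. ennreal ((s n - s (Suc n)) * \<alpha> (Suc n))) = ennreal (\<alpha> (Suc k))"
      using choquet_sum_finite [OF nonneg mono zero dec(1) singular_sysD(2) [OF svdD(1) [OF a]] s0]
        sum_increment [OF nonneg mono zero, of "Suc k"]
      by (simp add: s_def)
    then show "choquet_norm \<alpha> a = ennreal (\<alpha> (Suc k))" "choquet_norm \<alpha> b = ennreal (\<alpha> (Suc k))"
      by (simp_all add: svd_choquet_norm [OF a] svd_choquet_norm [OF b])
  qed
  moreover have "choquet_norm \<alpha> c = ennreal (\<alpha> (Suc (Suc k)) + \<alpha> k)"
  proof -
    \<comment> \<open>The eigenvalue 2 doubles the first \<open>k\<close> increments, which add up
      to \<open>2 * \<alpha> k\<close>; the two eigenvalues 1 contribute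
      \<open>\<alpha> (k + 2) - \<alpha> k\<close>.\<close>
    have "(\<Sum>n<Suc (Suc k). (\<alpha> (Suc n) - \<alpha> n) * u n) = (\<Sum>n<k. (\<alpha> (Suc n) - \<alpha> n) * 2) + \<alpha> (Suc (Suc k)) - \<alpha> k"
      by (simp add: u_def)
    also have "\<dots> = \<alpha> (Suc (Suc k)) + \<alpha> k"
      unfolding sum_distrib_right [symmetric] sum_increment [OF nonneg mono zero] by simp
    finally show ?thesis
      using choquet_sum_finite [OF nonneg mono zero dec(2) singular_sysD(2) [OF svdD(1) [OF c]] u0]
      by (simp add: svd_choquet_norm [OF c])
  qed
  ultimately have "ennreal (\<alpha> (Suc (Suc k)) + \<alpha> k) \<le> ennreal (\<alpha> (Suc k) + \<alpha> (Suc k))"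
    by (simp only: ennreal_plus [OF nonneg nonneg])
  then show ?thesis using nonneg by (subst (asm) ennreal_le_iff) auto
qed

section \<open>Equivalence of concavity, decreasing increments and the triangle inequality\<close>

theorem proposition3p4:
  fixes \<alpha> c :: "nat \<Rightarrow> real"
  assumes separable: "separable_space (euclidean :: 'h::complex_hilbert topology)"
    and infinite_dim: "\<not> (\<exists>B :: 'h set. finite B \<and> cspace.span B = UNIV)"
    and nonneg: "\<And>i. 0 \<le> \<alpha> i"
    and mono: "mono \<alpha>"
    and zero: "\<alpha> 0 = 0"
    and one: "\<alpha> 1 > 0"
    and c: "\<And>i. i \<ge> 1 \<Longrightarrow> c i = \<alpha> i - \<alpha> (i - 1)"
  shows "((\<forall>i\<ge>1. (\<alpha> (i + 1) + \<alpha> (i - 1)) / 2 \<le> \<alpha> i) \<longleftrightarrow> (\<forall>i\<ge>1. c i \<ge> c (i + 1)))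
       \<and> ((\<forall>i\<ge>1. c i \<ge> c (i + 1)) \<longleftrightarrow>
          (\<forall>a\<in>compact_ops. \<forall>b\<in>(compact_ops :: ('h \<Rightarrow> 'h) set).
             choquet_norm \<alpha> (\<lambda>x. a x + b x) \<le> choquet_norm \<alpha> a + choquet_norm \<alpha> b))"
proof -
  \<comment> \<open>Both sides rearrange to \<open>\<alpha> (i + 1) - \<alpha> i \<le> \<alpha> i -
    \<alpha> (i - 1)\<close>.\<close>
  have concave: "(\<alpha> (i + 1) + \<alpha> (i - 1)) / 2 \<le> \<alpha> i \<longleftrightarrow> c i \<ge> c (i + 1)" if "i \<ge> 1" for i
    using c [of i] c [of "i + 1"] that by auto
  moreover have "choquet_norm \<alpha> (\<lambda>x. a x + b x) \<le> choquet_norm \<alpha> a + choquet_norm \<alpha> b"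
    if dec: "\<forall>i\<ge>1. c i \<ge> c (i + 1)" and "a \<in> compact_ops" "b \<in> compact_ops" for a b :: "'h \<Rightarrow> 'h"
  proof -
    \<comment> \<open>The n-th term is \<open>c (n + 1)\<close>, so monotonicity of \<open>c\<close>
      from index 1 becomes \<open>decseq\<close> from index 0.\<close>
    have "decseq (\<lambda>n. \<alpha> (Suc n) - \<alpha> n)"
    proof (rule decseq_SucI)
      fix n
      show "\<alpha> (Suc (Suc n)) - \<alpha> (Suc n) \<le> \<alpha> (Suc n) - \<alpha> n"
        using dec [rule_format, of "Suc n"] c [of "Suc n"] c [of "Suc (Suc n)"] by simp
    qed
    then show ?thesis using that by (intro choquet_norm_triangle [OF nonneg mono zero])
  qed
  moreover have "(\<alpha> (i + 1) + \<alpha> (i - 1)) / 2 \<le> \<alpha> i"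
    if "\<forall>a\<in>compact_ops. \<forall>b\<in>(compact_ops :: ('h \<Rightarrow> 'h) set).
      choquet_norm \<alpha> (\<lambda>x. a x + b x) \<le> choquet_norm \<alpha> a + choquet_norm \<alpha> b" and "i \<ge> 1" for i
    using choquet_norm_triangle_imp_concave [OF infinite_dim nonneg mono zero, of "i - 1"] that by auto
  ultimately show ?thesis by blast
qed

end
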